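(* Let $\mathbb{K}$ be a field, $m\ge 1$, $n=2m$, $S=\mathbb{K}[x_1,\ldots,x_n]$, and let $X=X_m^{(1,n)}$ be the $m\times(m+1)$ generic Hankel matrix with entries $x_1,\ldots,x_n$. Let $f=\det X_m^{(1,n-1)}\cdot\det X_m^{(2,n)}\in S$. Then $I_t(X)\in\mathcal{C}_f$ for $t=1,\ldots,m$.
   Context: For integers $l\le n$ and $m$, $X_m^{(l,n)}$ denotes the generic Hankel matrix with $m$ rows and $n-m-l+2$ columns whose $(i,j)$ entry is $x_{l+i+j-2}$ (so its entries are $x_l,\ldots,x_n$). For a matrix $M$, $I_t(M)$ is the ideal of $S$ generated by all $t\times t$ minors of $M$. For $f\in S$, $\mathcal{C}_f$ denotes the smallest set of ideals of $S$ such that: (1) $(f)\in\mathcal{C}_f$; (2) if $I\in\mathcal{C}_f$ then $I:J\in\mathcal{C}_f$ for every ideal $J\subseteq S$; (3) if $I,J\in\mathcal{C}_f$ then $I+J\in\mathcal{C}_f$ and $I\cap J\in\mathcal{C}_f$. *)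

theory Defs
  imports "HOL-Library.Poly_Mapping" "Jordan_Normal_Form.Determinant" "Jordan_Normal_Form.DL_Submatrix"
begin

text \<open>Polynomials over a field K in variables indexed by nat:
  a polynomial is a finitely supported map from monomials (exponent vectors
  nat =>_0 nat) to coefficients.  The ring S = K[x_1,...,x_n] is the
  subring of polynomials only involving the variables x_1,...,x_n.\<close>

type_synonym 'k mpoly = "(nat \<Rightarrow>\<^sub>0 nat) \<Rightarrow>\<^sub>0 'k"

definition var :: "nat \<Rightarrow> 'k::field mpoly" where
  "var i = Poly_Mapping.single (Poly_Mapping.single i 1) 1"

definition polyS :: "nat \<Rightarrow> 'k::field mpoly set" where
  "polyS n = {p. \<forall>mo \<in> Poly_Mapping.keys p. Poly_Mapping.keys mo \<subseteq> {1..n}}"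

definition is_idealS :: "nat \<Rightarrow> 'k::field mpoly set \<Rightarrow> bool" where
  "is_idealS n I \<longleftrightarrow> I \<subseteq> polyS n \<and> 0 \<in> I \<and>
     (\<forall>a\<in>I. \<forall>b\<in>I. a + b \<in> I) \<and> (\<forall>r\<in>polyS n. \<forall>a\<in>I. r * a \<in> I)"

definition ideal_genS :: "nat \<Rightarrow> 'k::field mpoly set \<Rightarrow> 'k mpoly set" where
  "ideal_genS n G = \<Inter>{I. is_idealS n I \<and> G \<subseteq> I}"

definition colonS :: "nat \<Rightarrow> 'k::field mpoly set \<Rightarrow> 'k mpoly set \<Rightarrow> 'k mpoly set" where
  "colonS n I J = {a \<in> polyS n. \<forall>b\<in>J. a * b \<in> I}"

definition sum_ideal :: "'k::field mpoly set \<Rightarrow> 'k mpoly set \<Rightarrow> 'k mpoly set" where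
  "sum_ideal I J = {a + b | a b. a \<in> I \<and> b \<in> J}"

inductive_set classC :: "nat \<Rightarrow> 'k::field mpoly \<Rightarrow> 'k mpoly set set"
  for n :: nat and f :: "'k mpoly" where
  base: "ideal_genS n {f} \<in> classC n f"
| colon: "I \<in> classC n f \<Longrightarrow> is_idealS n J \<Longrightarrow> colonS n I J \<in> classC n f"
| plus: "I \<in> classC n f \<Longrightarrow> J \<in> classC n f \<Longrightarrow> sum_ideal I J \<in> classC n f"
| inter: "I \<in> classC n f \<Longrightarrow> J \<in> classC n f \<Longrightarrow> I \<inter> J \<in> classC n f"

text \<open>Generic Hankel matrix X_m^(l,n): m rows, n-m-l+2 columns, the
  (i,j) entry (1-based) is x_{l+i+j-2}; with 0-based indices it is x_{l+i+j}.\<close>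
definition hankel :: "nat \<Rightarrow> nat \<Rightarrow> nat \<Rightarrow> 'k::field mpoly mat" where
  "hankel m l n = mat m (n + 2 - m - l) (\<lambda>(i, j). var (l + i + j))"

definition minors :: "nat \<Rightarrow> 'k::field mpoly mat \<Rightarrow> 'k mpoly set" where
  "minors t M = {det (submatrix M R C) | R C.
      R \<subseteq> {..<dim_row M} \<and> C \<subseteq> {..<dim_col M} \<and> card R = t \<and> card C = t}"

definition minor_idealS :: "nat \<Rightarrow> nat \<Rightarrow> 'k::field mpoly mat \<Rightarrow> 'k mpoly set" where
  "minor_idealS n t M = ideal_genS n (minors t M)"

end

(* Let n = 2m. The closure of k points of the rational normal curve in P^(n-1), joined with the
   coordinate point of x_1 and/or x_n, is parametrized by a polynomial map, so its ideal Q is the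
   kernel of a substitution and is prime. Hence if A is in C_f and A lies in Q, then A : (g) lies in Q
   for every g outside Q: iterated colons adjoin to A every determinant d such that d g is in A
   for some such g.

   Descend on k. Suppose C_f contains an ideal A1 with all (k+1)-minors in x_1, ..., x_(n-1) and an
   ideal A2 with all those in x_2, ..., x_n, each contained in the corresponding prime (A1 in the join
   with the point of x_n, A2 in the join with the point of x_1). Three-term Pluecker relations,
   one or two of whose rows are unit vectors, give the elements g needed to enlarge A1 + A2, first to
   an ideal with all (k+1)-minors inside the prime of the k-th secant variety, and second to an ideal with all
   k-minors in x_2, ..., x_(n-1); the sum of these two yields the pair for k - 1.

   The first ideal equals I_(k+1)(X): it contains the minors, it vanishes on the secant variety, and
   every polynomial vanishing there reduces to 0 modulo the minors. For the last point use the weight i^2 for x_i,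
   for which the main diagonal of a Hankel minor is its leading term. If a
   monomial is not divisible by such a diagonal, its support is covered by k pairs {p, p+1}; giving
   the parameters of the k points the weights of the chords of i^2 through these pairs, the monomial
   survives the substitution. *)

theory Submission
  imports Defs
begin

abbreviation "lookup \<equiv> Poly_Mapping.lookup"
abbreviation "keys \<equiv> Poly_Mapping.keys"
abbreviation "single \<equiv> Poly_Mapping.single"

section \<open>Substitution of polynomials for the variables\<close>

definition eval_monomial :: "(nat \<Rightarrow> 'k::field mpoly) \<Rightarrow> (nat \<Rightarrow>\<^sub>0 nat) \<Rightarrow> 'k mpoly" where
  "eval_monomial v \<mu> = (\<Prod>i\<in>keys \<mu>. v i ^ lookup \<mu> i)"

text \<open>The algebra homomorphism sending \<open>var i\<close> to \<open>v i\<close>, with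
  scalars embedded as \<open>single 0 c\<close>. Its values stay in the same type, whose variables
  then serve as parameters of points on a curve.\<close>

definition subst :: "(nat \<Rightarrow> 'k::field mpoly) \<Rightarrow> 'k mpoly \<Rightarrow> 'k mpoly" where
  "subst v p = (\<Sum>\<mu>\<in>keys p. single 0 (lookup p \<mu>) * eval_monomial v \<mu>)"

lemma sum_single_keys:
  "p = (\<Sum>\<mu>\<in>keys p. single \<mu> (lookup p \<mu>))"
proof (rule poly_mapping_eqI)
  fix k
  have "lookup (\<Sum>\<mu>\<in>keys p. single \<mu> (lookup p \<mu>)) k
      = (\<Sum>\<mu>\<in>keys p. if \<mu> = k then lookup p \<mu> else 0)"
    by (simp add: lookup_sum lookup_single when_def)
  also have "\<dots> = lookup p k"
    by (auto simp: sum.delta in_keys_iff)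
  finally show "lookup p k = lookup (\<Sum>\<mu>\<in>keys p. single \<mu> (lookup p \<mu>)) k"
    by simp
qed

lemma eval_monomial_superset:
  assumes "finite A" "keys \<mu> \<subseteq> A"
  shows "eval_monomial v \<mu> = (\<Prod>i\<in>A. v i ^ lookup \<mu> i)"
  unfolding eval_monomial_def
  by (rule prod.mono_neutral_left) (use assms in \<open>auto simp: in_keys_iff\<close>)

lemma eval_monomial_add: "eval_monomial v (\<mu> + \<nu>) = eval_monomial v \<mu> * eval_monomial v \<nu>"
proof -
  let ?A = "keys \<mu> \<union> keys \<nu>"
  have "eval_monomial v (\<mu> + \<nu>) = (\<Prod>i\<in>?A. v i ^ lookup (\<mu> + \<nu>) i)"
    by (rule eval_monomial_superset) (simp_all add: Poly_Mapping.keys_add)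
  also have "\<dots> = (\<Prod>i\<in>?A. v i ^ lookup \<mu> i) * (\<Prod>i\<in>?A. v i ^ lookup \<nu> i)"
    by (simp add: lookup_add power_add prod.distrib)
  also have "\<dots> = eval_monomial v \<mu> * eval_monomial v \<nu>"
    by (subst (1 2) eval_monomial_superset[of ?A]) auto
  finally show ?thesis .
qed

lemma eval_monomial_zero [simp]: "eval_monomial v 0 = 1"
  by (simp add: eval_monomial_def)

lemma subst_superset:
  assumes "finite A" "keys p \<subseteq> A"
  shows "subst v p = (\<Sum>\<mu>\<in>A. single 0 (lookup p \<mu>) * eval_monomial v \<mu>)"
  unfolding subst_def
  by (rule sum.mono_neutral_left) (use assms in \<open>auto simp: in_keys_iff\<close>)

lemma subst_zero [simp]: "subst v 0 = 0"
  by (simp add: subst_def)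

lemma subst_single [simp]: "subst v (single \<mu> c) = single 0 c * eval_monomial v \<mu>"
  by (subst subst_superset[of "{\<mu>}"]) auto

lemma subst_add [simp]: "subst v (p + q) = subst v p + subst v q"
proof -
  let ?A = "keys p \<union> keys q"
  have "subst v (p + q) = (\<Sum>\<mu>\<in>?A. single 0 (lookup (p + q) \<mu>) * eval_monomial v \<mu>)"
    by (rule subst_superset) (simp_all add: Poly_Mapping.keys_add)
  also have "\<dots> = (\<Sum>\<mu>\<in>?A. single 0 (lookup p \<mu>) * eval_monomial v \<mu>)
     + (\<Sum>\<mu>\<in>?A. single 0 (lookup q \<mu>) * eval_monomial v \<mu>)"
    by (simp add: lookup_add single_add algebra_simps sum.distrib)
  also have "\<dots> = subst v p + subst v q"
    by (subst (1 2) subst_superset[of ?A]) auto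
  finally show ?thesis .
qed

lemma subst_sum: "subst v (sum f A) = (\<Sum>a\<in>A. subst v (f a))"
  by (induction A rule: infinite_finite_induct) auto

text \<open>Both sides are biadditive, so after expansion into terms only products of two terms have
  to be compared.\<close>

lemma subst_mult [simp]: "subst v (p * q) = subst v p * subst v q"
proof -
  let ?s = "\<lambda>p. \<Sum>\<mu>\<in>keys p. single \<mu> (lookup p \<mu>)"
  have 1: "subst v (single \<mu> a * single \<nu> b)
      = subst v (single \<mu> a) * subst v (single \<nu> b)" for \<mu> \<nu> a b
  proof -
    have "single 0 (a * b) = single (0 :: nat \<Rightarrow>\<^sub>0 nat) a * single 0 b"
      by (simp add: mult_single)
    thus ?thesis
      by (simp only: mult_single[of \<mu> a \<nu> b] subst_single eval_monomial_add ac_simps)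
  qed
  have "subst v (?s p * ?s q) = subst v (?s p) * subst v (?s q)"
    by (simp only: sum_product subst_sum 1)
  thus ?thesis
    by (simp only: sum_single_keys[symmetric])
qed

lemma subst_one [simp]: "subst v 1 = 1"
  using subst_single[of v 0 1] by simp

lemma comm_ring_hom_subst: "comm_ring_hom (subst v)"
  by unfold_locales auto

lemma subst_power [simp]: "subst v (p ^ k) = subst v p ^ k"
  by (induction k) auto

lemma subst_uminus [simp]: "subst v (- p) = - subst v p"
  using subst_add[of v p "- p"] by (simp add: eq_neg_iff_add_eq_0 add.commute)

lemma subst_prod: "subst v (prod f A) = (\<Prod>a\<in>A. subst v (f a))"
  by (induction A rule: infinite_finite_induct) auto

lemma subst_var [simp]: "subst v (var i) = v i"
  by (simp add: var_def eval_monomial_def)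

lemma subst_subst: "subst w (subst v p) = subst (\<lambda>i. subst w (v i)) p"
  by (simp add: subst_def[of v] subst_def[of "\<lambda>i. subst w (v i)"] subst_sum eval_monomial_def subst_prod)

subsection \<open>The ring S and its ideals\<close>

lemma zero_polyS [simp]: "0 \<in> polyS n"
  by (simp add: polyS_def)

lemma one_polyS [simp]: "1 \<in> polyS n"
  by (simp add: polyS_def)

lemma var_polyS: "1 \<le> i \<Longrightarrow> i \<le> n \<Longrightarrow> var i \<in> polyS n"
  by (simp add: polyS_def var_def)

lemma single_polyS: "keys \<mu> \<subseteq> {1..n} \<Longrightarrow> single \<mu> c \<in> polyS n"
  by (simp add: polyS_def)

lemma add_polyS: "p \<in> polyS n \<Longrightarrow> q \<in> polyS n \<Longrightarrow> p + q \<in> polyS n"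
  unfolding polyS_def using keys_add[of p q] by blast

lemma uminus_polyS: "p \<in> polyS n \<Longrightarrow> - p \<in> polyS n"
  unfolding polyS_def by (simp add: keys.rep_eq)

lemma mult_polyS: "p \<in> polyS n \<Longrightarrow> q \<in> polyS n \<Longrightarrow> p * q \<in> polyS n"
proof -
  assume pq: "p \<in> polyS n" "q \<in> polyS n"
  have "keys \<mu> \<subseteq> {1..n}" if \<mu>: "\<mu> \<in> keys (p * q)" for \<mu>
  proof -
    obtain a b where "\<mu> = a + b" "a \<in> keys p" "b \<in> keys q"
      using \<mu> keys_mult[of p q] by blast
    thus ?thesis using pq Poly_Mapping.keys_add[of a b] unfolding polyS_def by blast
  qed
  thus ?thesis by (simp add: polyS_def)
qed

lemma sum_polyS: "(\<And>a. a \<in> A \<Longrightarrow> f a \<in> polyS n) \<Longrightarrow> sum f A \<in> polyS n"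
  by (induction A rule: infinite_finite_induct) (auto intro: add_polyS)

lemma prod_polyS: "(\<And>a. a \<in> A \<Longrightarrow> f a \<in> polyS n) \<Longrightarrow> prod f A \<in> polyS n"
  by (induction A rule: infinite_finite_induct) (auto intro: mult_polyS)

lemma det_polyS:
  assumes A: "A \<in> carrier_mat k k" and "\<And>i j. i < k \<Longrightarrow> j < k \<Longrightarrow> A $$ (i, j) \<in> polyS n"
  shows "det A \<in> polyS n"
proof -
  have "p i < k" if "p permutes {0..<k}" "i < k" for p i
    using permutes_in_image[OF that(1), of i] that(2) by simp
  thus ?thesis
    unfolding det_def'[OF A] using assms(2)
    by (intro sum_polyS mult_polyS prod_polyS) (auto simp: sign_def uminus_polyS)
qed

lemma is_idealS_sub: "is_idealS n I \<Longrightarrow> I \<subseteq> polyS n"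
  and is_idealS_zero: "is_idealS n I \<Longrightarrow> 0 \<in> I"
  and is_idealS_add: "is_idealS n I \<Longrightarrow> a \<in> I \<Longrightarrow> b \<in> I \<Longrightarrow> a + b \<in> I"
  and is_idealS_mult: "is_idealS n I \<Longrightarrow> a \<in> I \<Longrightarrow> r \<in> polyS n \<Longrightarrow> r * a \<in> I"
  by (auto simp: is_idealS_def)

lemma is_idealS_uminus: "is_idealS n I \<Longrightarrow> a \<in> I \<Longrightarrow> - a \<in> I"
  using is_idealS_mult[of n I a "- 1"] by (simp add: uminus_polyS)

lemma is_idealS_diff: "is_idealS n I \<Longrightarrow> a \<in> I \<Longrightarrow> b \<in> I \<Longrightarrow> a - b \<in> I"
  using is_idealS_add[of n I a "- b"] by (simp add: is_idealS_uminus)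

lemma is_idealS_ideal_genS:
  assumes "G \<subseteq> polyS n"
  shows "is_idealS n (ideal_genS n G)"
proof -
  have "is_idealS n (polyS n)"
    by (simp add: is_idealS_def add_polyS mult_polyS)
  hence "ideal_genS n G \<subseteq> polyS n"
    unfolding ideal_genS_def using assms by blast
  thus ?thesis
    unfolding is_idealS_def ideal_genS_def by blast
qed

lemma ideal_genS_superset: "G \<subseteq> ideal_genS n G"
  unfolding ideal_genS_def by blast

lemma ideal_genS_least: "is_idealS n I \<Longrightarrow> G \<subseteq> I \<Longrightarrow> ideal_genS n G \<subseteq> I"
  unfolding ideal_genS_def by blast

lemma is_idealS_principal:
  fixes g :: "'k::field mpoly"
  shows "g \<in> polyS n \<Longrightarrow> is_idealS n {r * g | r. r \<in> polyS n}"
  unfolding is_idealS_def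
proof (intro conjI ballI)
  assume g: "g \<in> polyS n"
  show "{r * g | r. r \<in> polyS n} \<subseteq> polyS n"
    using g by (auto intro: mult_polyS)
  show "0 \<in> {r * g | r. r \<in> polyS n}"
    by (auto intro!: exI[of _ 0])
next
  fix a b assume "a \<in> {r * g | r. r \<in> polyS n}" "b \<in> {r * g | r. r \<in> polyS n}"
  thus "a + b \<in> {r * g | r. r \<in> polyS n}"
    by (auto simp flip: distrib_right intro: add_polyS)
next
  fix a b :: "'k mpoly" assume "a \<in> polyS n" "b \<in> {r * g | r. r \<in> polyS n}"
  thus "a * b \<in> {r * g | r. r \<in> polyS n}"
    by (auto simp flip: mult.assoc intro: mult_polyS)
qed

lemma is_idealS_colonS:
  fixes I :: "'k::field mpoly set"
  assumes I: "is_idealS n I"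
  shows "is_idealS n (colonS n I J)"
  unfolding is_idealS_def
proof (intro conjI ballI)
  show "colonS n I J \<subseteq> polyS n" "0 \<in> colonS n I J"
    using is_idealS_zero[OF I] by (auto simp: colonS_def)
next
  fix a b assume "a \<in> colonS n I J" "b \<in> colonS n I J"
  thus "a + b \<in> colonS n I J"
    using is_idealS_add[OF I] by (simp add: colonS_def add_polyS distrib_right)
next
  fix r a :: "'k mpoly" assume "r \<in> polyS n" "a \<in> colonS n I J"
  thus "r * a \<in> colonS n I J"
    using is_idealS_mult[OF I] by (simp add: colonS_def mult_polyS mult.assoc)
qed

lemma is_idealS_sum_ideal:
  fixes I :: "'k::field mpoly set"
  assumes I: "is_idealS n I" and J: "is_idealS n J"
  shows "is_idealS n (sum_ideal I J)"
  unfolding is_idealS_def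
proof (intro conjI ballI)
  show "sum_ideal I J \<subseteq> polyS n"
    using I J unfolding is_idealS_def sum_ideal_def by (auto intro!: add_polyS)
  show "0 \<in> sum_ideal I J"
    using is_idealS_zero[OF I] is_idealS_zero[OF J] unfolding sum_ideal_def by force
next
  fix a b assume "a \<in> sum_ideal I J" "b \<in> sum_ideal I J"
  then obtain a1 a2 b1 b2 where *: "a = a1 + a2" "b = b1 + b2" "a1 \<in> I" "b1 \<in> I" "a2 \<in> J" "b2 \<in> J"
    unfolding sum_ideal_def by blast
  hence "a + b = (a1 + b1) + (a2 + b2)" by simp
  thus "a + b \<in> sum_ideal I J"
    using * is_idealS_add[OF I] is_idealS_add[OF J] unfolding sum_ideal_def by blast
next
  fix r a :: "'k mpoly" assume r: "r \<in> polyS n" and "a \<in> sum_ideal I J"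
  then obtain a1 a2 where *: "a = a1 + a2" "a1 \<in> I" "a2 \<in> J"
    unfolding sum_ideal_def by blast
  hence "r * a = r * a1 + r * a2" by (simp add: distrib_left)
  thus "r * a \<in> sum_ideal I J"
    using * r is_idealS_mult[OF I] is_idealS_mult[OF J] unfolding sum_ideal_def by blast
qed

lemma sum_ideal_left: "is_idealS n J \<Longrightarrow> I \<subseteq> sum_ideal I J"
  using is_idealS_zero unfolding sum_ideal_def by force

lemma sum_ideal_right: "is_idealS n I \<Longrightarrow> J \<subseteq> sum_ideal I J"
  using is_idealS_zero unfolding sum_ideal_def by force

section \<open>Ideals of the class and their enlargement by colons\<close>

lemma is_idealS_classC:
  assumes "f \<in> polyS n" "I \<in> classC n f"
  shows "is_idealS n I"
  using assms(2)
proof induction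
  case base
  show ?case using assms(1) by (simp add: is_idealS_ideal_genS)
next
  case (inter I J)
  thus ?case unfolding is_idealS_def by blast
qed (auto intro: is_idealS_colonS is_idealS_sum_ideal dest: is_idealS_sub)

text \<open>Each colon by an element outside the prime \<open>ker (subst v)\<close> stays inside that prime.\<close>

lemma classC_extend:
  assumes f: "f \<in> polyS n" and "A \<in> classC n f" and "\<And>p. p \<in> A \<Longrightarrow> subst v p = 0"
    and "finite N"
    and "\<And>x. x \<in> N \<Longrightarrow> x \<in> polyS n \<and> (\<exists>g\<in>polyS n. subst v g \<noteq> 0 \<and> x * g \<in> A)"
  shows "\<exists>B\<in>classC n f. A \<subseteq> B \<and> N \<subseteq> B \<and> (\<forall>p\<in>B. subst v p = 0)"
  using \<open>finite N\<close> assms(5)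
proof (induction N rule: finite_induct)
  case empty
  thus ?case using assms(2,3) by blast
next
  case (insert x N)
  then obtain B where B: "B \<in> classC n f" "A \<subseteq> B" "N \<subseteq> B" "\<forall>p\<in>B. subst v p = 0"
    by (meson insertCI)
  obtain g where g: "x \<in> polyS n" "g \<in> polyS n" "subst v g \<noteq> 0" "x * g \<in> A"
    using insert.prems by blast
  let ?J = "{r * g | r. r \<in> polyS n}"
  let ?C = "colonS n B ?J"
  have BI: "is_idealS n B" by (rule is_idealS_classC[OF f B(1)])
  have "?C \<in> classC n f"
    by (rule classC.colon[OF B(1) is_idealS_principal[OF g(2)]])
  moreover have "B \<subseteq> ?C"
  proof
    fix b assume b: "b \<in> B"
    have "b * (r * g) \<in> B" if "r \<in> polyS n" for r
      using is_idealS_mult[OF BI b, of "r * g"] that g(2) by (simp add: mult_polyS mult.commute)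
    thus "b \<in> ?C" unfolding colonS_def using b is_idealS_sub[OF BI] by blast
  qed
  moreover have "x \<in> ?C"
  proof -
    have "x * (r * g) \<in> B" if "r \<in> polyS n" for r
      using is_idealS_mult[OF BI, of "x * g" r] that g(4) B(2) by (auto simp: ac_simps)
    thus ?thesis unfolding colonS_def using g(1) by blast
  qed
  moreover have "subst v p = 0" if "p \<in> ?C" for p
  proof -
    \<comment> \<open>The multiplier 1 gives p g in \<open>B\<close>; since polynomials have no zero
      divisors, the kernel is prime and contains p.\<close>
    have "1 * g \<in> ?J" by (rule CollectI, rule exI[of _ 1]) simp
    hence "p * (1 * g) \<in> B" using that unfolding colonS_def by blast
    hence "subst v (p * (1 * g)) = 0" using B(4) by blast
    thus ?thesis using g(3) by simp
  qed
  ultimately show ?case using B by (intro bexI[of _ ?C]) auto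
qed

subsection \<open>Weights and leading forms\<close>

text \<open>Integer-valued, because the parameter weights \<open>tw\<close> below can be
  negative.\<close>

definition weight :: "(nat \<Rightarrow> int) \<Rightarrow> (nat \<Rightarrow>\<^sub>0 nat) \<Rightarrow> int" where
  "weight w \<mu> = (\<Sum>i\<in>keys \<mu>. int (lookup \<mu> i) * w i)"

lemma weight_superset:
  assumes "finite A" "keys \<mu> \<subseteq> A"
  shows "weight w \<mu> = (\<Sum>i\<in>A. int (lookup \<mu> i) * w i)"
  unfolding weight_def
  by (rule sum.mono_neutral_left) (use assms in \<open>auto simp: in_keys_iff\<close>)

lemma weight_zero [simp]: "weight w 0 = 0"
  by (simp add: weight_def)

lemma weight_single [simp]: "weight w (single i k) = int k * w i"
  by (subst weight_superset[of "{i}"]) auto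

lemma weight_add [simp]: "weight w (\<mu> + \<nu>) = weight w \<mu> + weight w \<nu>"
proof -
  let ?A = "keys \<mu> \<union> keys \<nu>"
  have "weight w (\<mu> + \<nu>) = (\<Sum>i\<in>?A. int (lookup (\<mu> + \<nu>) i) * w i)"
    by (rule weight_superset) (simp_all add: Poly_Mapping.keys_add)
  also have "\<dots> = (\<Sum>i\<in>?A. int (lookup \<mu> i) * w i) + (\<Sum>i\<in>?A. int (lookup \<nu> i) * w i)"
    by (simp add: lookup_add distrib_right sum.distrib)
  also have "\<dots> = weight w \<mu> + weight w \<nu>"
    by (subst (1 2) weight_superset[of ?A]) auto
  finally show ?thesis .
qed

lemma weight_sum: "weight w (sum f A) = (\<Sum>a\<in>A. weight w (f a))"
  by (induction A rule: infinite_finite_induct) auto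

text \<open>\<open>p\<close> equals \<open>single \<mu> c\<close> up to terms of weight below
  \<open>W\<close>. For \<open>c = 0\<close> the monomial is arbitrary and all of \<open>p\<close>
  has weight below \<open>W\<close>; admitting this case makes the notion multiplicative without
  exceptions.\<close>

definition top_form :: "(nat \<Rightarrow> int) \<Rightarrow> int \<Rightarrow> 'k \<Rightarrow> (nat \<Rightarrow>\<^sub>0 nat) \<Rightarrow> 'k::field mpoly \<Rightarrow> bool" where
  "top_form w W c \<mu> p \<longleftrightarrow> (c \<noteq> 0 \<longrightarrow> weight w \<mu> = W) \<and> (\<forall>\<nu>\<in>keys (p - single \<mu> c). weight w \<nu> < W)"

lemma top_formI:
  "p = single \<mu> c + q \<Longrightarrow> (c \<noteq> 0 \<Longrightarrow> weight w \<mu> = W) \<Longrightarrow> (\<And>\<nu>. \<nu> \<in> keys q \<Longrightarrow> weight w \<nu> < W)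
    \<Longrightarrow> top_form w W c \<mu> p"
  by (simp add: top_form_def)

lemma top_formE:
  assumes "top_form w W c \<mu> p"
  obtains q where "p = single \<mu> c + q" "c \<noteq> 0 \<longrightarrow> weight w \<mu> = W"
    "\<forall>\<nu>\<in>keys q. weight w \<nu> < W"
proof
  show "p = single \<mu> c + (p - single \<mu> c)" by simp
qed (use assms in \<open>auto simp: top_form_def\<close>)

lemma top_form_one: "top_form w 0 1 0 1"
  by (rule top_formI[of _ _ _ 0]) simp_all

lemma top_form_mult:
  assumes "top_form w W c \<mu> p" "top_form w W' c' \<mu>' p'"
  shows "top_form w (W + W') (c * c') (\<mu> + \<mu>') (p * p')"
proof -
  obtain q where q: "p = single \<mu> c + q" "c \<noteq> 0 \<longrightarrow> weight w \<mu> = W"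
    "\<forall>\<nu>\<in>keys q. weight w \<nu> < W"
    using assms(1) by (rule top_formE)
  obtain q' where q': "p' = single \<mu>' c' + q'" "c' \<noteq> 0 \<longrightarrow> weight w \<mu>' = W'"
    "\<forall>\<nu>\<in>keys q'. weight w \<nu> < W'"
    using assms(2) by (rule top_formE)
  have 1: "weight w \<nu> < W + W'" if \<nu>: "\<nu> \<in> keys (single \<mu> c * q')" for \<nu>
  proof -
    obtain a b where ab: "\<nu> = a + b" "a \<in> keys (single \<mu> c)" "b \<in> keys q'"
      using \<nu> keys_mult[of "single \<mu> c" q'] by blast
    have "weight w a = W" using ab(2) q(2) by (simp split: if_splits)
    moreover have "weight w b < W'" using ab(3) q'(3) by blast
    ultimately show ?thesis by (simp add: ab(1))
  qed
  have 2: "weight w \<nu> < W + W'" if \<nu>: "\<nu> \<in> keys (q * p')" for \<nu>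
  proof -
    obtain a b where ab: "\<nu> = a + b" "a \<in> keys q" "b \<in> keys p'"
      using \<nu> keys_mult[of q p'] by blast
    have "b \<in> keys (single \<mu>' c') \<or> b \<in> keys q'"
      using ab(3) Poly_Mapping.keys_add[of "single \<mu>' c'" q'] unfolding q'(1) by blast
    hence "weight w b \<le> W'"
    proof
      assume "b \<in> keys (single \<mu>' c')"
      thus ?thesis using q'(2) by (simp split: if_splits)
    next
      assume "b \<in> keys q'"
      hence "weight w b < W'" using q'(3) by blast
      thus ?thesis by simp
    qed
    moreover have "weight w a < W" using ab(2) q(3) by blast
    ultimately show ?thesis by (simp add: ab(1))
  qed
  show ?thesis
  proof (rule top_formI)
    show "p * p' = single (\<mu> + \<mu>') (c * c') + (single \<mu> c * q' + q * p')"
      unfolding q(1) q'(1) by (simp add: distrib_left distrib_right mult_single add.assoc)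
    show "weight w (\<mu> + \<mu>') = W + W'" if "c * c' \<noteq> 0"
      using that q(2) q'(2) by simp
    show "weight w \<nu> < W + W'" if "\<nu> \<in> keys (single \<mu> c * q' + q * p')" for \<nu>
    proof -
      have "\<nu> \<in> keys (single \<mu> c * q') \<or> \<nu> \<in> keys (q * p')"
        using that Poly_Mapping.keys_add[of "single \<mu> c * q'" "q * p'"] by blast
      thus ?thesis using 1 2 by blast
    qed
  qed
qed

lemma top_form_prod:
  assumes "finite A" "\<And>i. i \<in> A \<Longrightarrow> top_form w (W i) (c i) (h i) (p i)"
  shows "top_form w (\<Sum>i\<in>A. W i) (\<Prod>i\<in>A. c i) (\<Sum>i\<in>A. h i) (\<Prod>i\<in>A. p i)"
  using assms by (induction A rule: finite_induct) (auto simp: top_form_one intro!: top_form_mult)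

lemma top_form_power:
  assumes "top_form w W c h p"
  shows "top_form w (int k * W) (c ^ k) (\<Sum>j<k. h) (p ^ k)"
  using top_form_prod[of "{..<k}" w "\<lambda>_. W" "\<lambda>_. c" "\<lambda>_. h" "\<lambda>_. p"] assms by simp

text \<open>The constant inner sum is the multiple of the exponent vector \<open>h i\<close> by the
  exponent of variable \<open>i\<close>.\<close>

definition image_monomial :: "(nat \<Rightarrow> (nat \<Rightarrow>\<^sub>0 nat)) \<Rightarrow> (nat \<Rightarrow>\<^sub>0 nat) \<Rightarrow> (nat \<Rightarrow>\<^sub>0 nat)" where
  "image_monomial h \<mu> = (\<Sum>i\<in>keys \<mu>. \<Sum>j<lookup \<mu> i. h i)"

lemma lookup_image_monomial:
  "lookup (image_monomial h \<mu>) x = (\<Sum>i\<in>keys \<mu>. lookup \<mu> i * lookup (h i) x)"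
  by (simp add: image_monomial_def lookup_sum del: sum_constant) simp

text \<open>\<open>C\<close> collects the variables whose image attains its weight bound. A single
  variable outside \<open>C\<close> makes the leading coefficient of the product 0.\<close>

lemma top_form_eval_monomial:
  assumes "\<And>i. i \<in> keys \<mu> \<Longrightarrow> top_form w (W i) (if i \<in> C then 1 else 0) (h i) (v i)"
  shows "top_form w (weight W \<mu>) (if keys \<mu> \<subseteq> C then 1 else 0) (image_monomial h \<mu>) (eval_monomial v \<mu>)"
proof -
  have "top_form w (\<Sum>i\<in>keys \<mu>. int (lookup \<mu> i) * W i) (\<Prod>i\<in>keys \<mu>. (if i \<in> C then 1 else 0) ^ lookup \<mu> i)
      (\<Sum>i\<in>keys \<mu>. \<Sum>j<lookup \<mu> i. h i) (\<Prod>i\<in>keys \<mu>. v i ^ lookup \<mu> i)"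
    by (rule top_form_prod[OF finite_keys], rule top_form_power, rule assms)
  moreover have "(\<Prod>i\<in>keys \<mu>. (if i \<in> C then 1 else 0 :: 'a) ^ lookup \<mu> i) = (if keys \<mu> \<subseteq> C then 1 else 0)"
    by (auto simp: prod_zero_iff in_keys_iff zero_power intro!: prod.neutral)
  ultimately show ?thesis
    by (simp only: weight_def image_monomial_def eval_monomial_def)
qed

text \<open>A substitution cannot kill a polynomial if its monomials of maximal weight that survive in the
  initial form are sent to distinct monomials.\<close>

lemma subst_nonzero:
  fixes F :: "'k::field mpoly"
  assumes v: "\<And>i. i \<in> V \<Longrightarrow> top_form w (W i) (if i \<in> C then 1 else 0) (h i) (v i)"
    and inj: "\<And>\<mu> \<nu>. keys \<mu> \<subseteq> C \<Longrightarrow> keys \<nu> \<subseteq> C \<Longrightarrow> image_monomial h \<mu> = image_monomial h \<nu> \<Longrightarrow> \<mu> = \<nu>"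
    and F: "\<And>\<nu>. \<nu> \<in> keys F \<Longrightarrow> keys \<nu> \<subseteq> V \<and> weight W \<nu> \<le> weight W \<mu>"
    and \<mu>: "\<mu> \<in> keys F" "keys \<mu> \<subseteq> C"
  shows "subst v F \<noteq> 0"
proof -
  let ?m = "image_monomial h \<mu>"
  have top: "top_form w (weight W \<nu>) (if keys \<nu> \<subseteq> C then 1 else 0) (image_monomial h \<nu>) (eval_monomial v \<nu>)"
    if "\<nu> \<in> keys F" for \<nu>
    by (rule top_form_eval_monomial) (use F[OF that] in \<open>blast intro: v\<close>)
  have wm: "weight w ?m = weight W \<mu>"
    using top[OF \<mu>(1)] \<mu>(2) by (simp add: top_form_def)
  \<comment> \<open>The coefficients at \<open>?m\<close> form a Kronecker delta: lower terms of
    every image weigh less than \<open>?m\<close>, and \<open>inj\<close> separates the leading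
    ones.\<close>
  have "lookup (eval_monomial v \<nu>) ?m = (if \<nu> = \<mu> then 1 else 0)" if \<nu>: "\<nu> \<in> keys F" for \<nu>
  proof -
    obtain q where q: "eval_monomial v \<nu> = single (image_monomial h \<nu>) (if keys \<nu> \<subseteq> C then 1 else 0) + q"
      "\<forall>k\<in>keys q. weight w k < weight W \<nu>"
      using top[OF \<nu>] by (rule top_formE)
    have "?m \<notin> keys q" using q(2) F[OF \<nu>] wm by force
    hence "lookup (eval_monomial v \<nu>) ?m = (if keys \<nu> \<subseteq> C \<and> image_monomial h \<nu> = ?m then 1 else 0)"
      unfolding q(1) by (auto simp: lookup_add lookup_single when_def in_keys_iff)
    thus ?thesis using inj[of \<nu> \<mu>] \<mu>(2) by auto
  qed
  hence 1: "lookup (eval_monomial v \<nu>) ?m = (if \<nu> = \<mu> then 1 else 0)" if "\<nu> \<in> keys F" for \<nu>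
    using that .
  have "lookup (single 0 c * p) k = c * lookup p k" for c :: 'k and p and k :: "nat \<Rightarrow>\<^sub>0 nat"
    by (simp add: Poly_Mapping.map.rep_eq when_def flip: mult_map_scale_conv_mult)
  hence "lookup (subst v F) ?m = (\<Sum>\<nu>\<in>keys F. lookup F \<nu> * (if \<nu> = \<mu> then 1 else 0))"
    by (simp add: subst_def lookup_sum 1)
  also have "\<dots> = lookup F \<mu>"
    by (subst sum.remove[OF _ \<mu>(1)]) (auto intro: sum.neutral)
  finally show ?thesis using \<mu>(1) by (auto simp: in_keys_iff)
qed

subsection \<open>Determinants of lists of rows\<close>

text \<open>Rows are functions on all of nat, cut off at the length of the list, so the same row can
  occur in determinants of every size.\<close>

definition bracket :: "(nat \<Rightarrow> 'a::comm_ring_1) list \<Rightarrow> 'a" where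
  "bracket vs = det (mat (length vs) (length vs) (\<lambda>(i, j). (vs ! i) j))"

text \<open>The sign of the permutation of the rows is left undetermined, since membership in an
  ideal ignores it.\<close>

lemma bracket_mset:
  assumes "mset vs = mset ws"
  shows "bracket vs = bracket ws \<or> bracket vs = - bracket ws"
proof -
  let ?n = "length ws"
  obtain p where p: "p permutes {..<?n}" "permute_list p ws = vs"
    using mset_eq_permutation[OF assms] by blast
  let ?A = "mat ?n ?n (\<lambda>(i, j). (ws ! i) j)"
  have len: "length vs = ?n" using assms by (rule mset_eq_length)
  have "mat ?n ?n (\<lambda>(i, j). (vs ! i) j) = mat ?n ?n (\<lambda>(i, j). ?A $$ (p i, j))"
    using p(1) by (intro eq_matI) (auto simp: permute_list_nth[OF p(1)] permutes_in_image[of p "{..<?n}", simplified] simp flip: p(2))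
  moreover have "p permutes {0..<?n}" using p(1) by (simp add: lessThan_atLeast0)
  ultimately have "bracket vs = signof p * bracket ws"
    unfolding bracket_def len by (simp add: det_permute_rows[of ?A])
  thus ?thesis by (auto simp: sign_def)
qed

lemma bracket_not_distinct:
  assumes "\<not> distinct vs"
  shows "bracket vs = 0"
proof -
  obtain i j where ij: "i < length vs" "j < length vs" "i \<noteq> j" "vs ! i = vs ! j"
    using assms by (auto simp: distinct_conv_nth)
  show ?thesis
    unfolding bracket_def
    by (rule det_identical_rows[OF _ ij(3,1,2)]) (use ij in \<open>auto intro!: eq_vecI\<close>)
qed

text \<open>Laplace expansion along the first row; the cofactors \<open>K\<close> depend only on the
  other rows.\<close>

lemma bracket_Cons_linear:
  obtains K where "\<And>v :: nat \<Rightarrow> 'a::comm_ring_1. bracket (v # vs) = (\<Sum>j<Suc (length vs). v j * K j)"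
proof -
  let ?n = "Suc (length vs)"
  define M where "M v = mat ?n ?n (\<lambda>(i, j). ((v # vs) ! i) j)" for v :: "nat \<Rightarrow> 'a"
  have del: "mat_delete (M v) 0 j = mat_delete (M (\<lambda>_. 0)) 0 j" for v j
    by (rule eq_matI) (auto simp: mat_delete_def M_def)
  have "bracket (v # vs) = (\<Sum>j<?n. v j * cofactor (M (\<lambda>_. 0)) 0 j)" for v
  proof -
    have "bracket (v # vs) = (\<Sum>j<?n. M v $$ (0, j) * cofactor (M v) 0 j)"
      using laplace_expansion_row[of "M v" ?n 0] by (simp add: bracket_def M_def)
    also have "\<dots> = (\<Sum>j<?n. v j * cofactor (M (\<lambda>_. 0)) 0 j)"
      by (intro sum.cong refl) (simp add: cofactor_def del[of v], simp add: M_def)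
    finally show ?thesis .
  qed
  thus ?thesis by (rule that)
qed

text \<open>Cramer's rule without division: multiply \<open>adj_mat M * M\<close> = det M times the
  identity by the row \<open>d\<close> from the left.\<close>

lemma cramer_rows:
  fixes d :: "nat \<Rightarrow> 'a::comm_ring_1"
  assumes j: "j < length vs"
  shows "(\<Sum>i<length vs. bracket (vs[i := d]) * (vs ! i) j) = bracket vs * d j"
proof -
  let ?n = "length vs"
  define M where "M = mat ?n ?n (\<lambda>(i, j). (vs ! i) j)"
  have M: "M \<in> carrier_mat ?n ?n" by (simp add: M_def)
  have adj: "(\<Sum>i<?n. cofactor M i l * M $$ (i, j)) = (if l = j then det M else 0)" if l: "l < ?n" for l
  proof -
    have "(adj_mat M * M) $$ (l, j) = (det M \<cdot>\<^sub>m 1\<^sub>m ?n) $$ (l, j)"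
      using adj_mat(3)[OF M] by simp
    thus ?thesis
      using l j M by (simp add: adj_mat_def scalar_prod_def atLeast0LessThan)
  qed
  have "bracket (vs[i := d]) = (\<Sum>l<?n. d l * cofactor M i l)" if i: "i < ?n" for i
  proof -
    let ?N = "mat ?n ?n (\<lambda>(i', j). (vs[i := d] ! i') j)"
    have "mat_delete ?N i l = mat_delete M i l" for l
      by (rule eq_matI) (auto simp: mat_delete_def M_def)
    hence "cofactor ?N i l = cofactor M i l" for l by (simp add: cofactor_def)
    thus ?thesis
      using laplace_expansion_row[of ?N ?n i] i by (simp add: bracket_def)
  qed
  hence "(\<Sum>i<?n. bracket (vs[i := d]) * (vs ! i) j)
      = (\<Sum>i<?n. \<Sum>l<?n. d l * (cofactor M i l * M $$ (i, j)))"
    using j by (simp add: M_def sum_distrib_right mult.assoc)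
  also have "\<dots> = (\<Sum>l<?n. d l * (\<Sum>i<?n. cofactor M i l * M $$ (i, j)))"
    by (subst sum.swap) (simp add: sum_distrib_left)
  also have "\<dots> = (\<Sum>l<?n. if l = j then det M * d j else 0)"
    by (intro sum.cong refl) (simp add: adj mult.commute)
  also have "\<dots> = det M * d j" using j by simp
  finally show ?thesis by (simp add: bracket_def M_def)
qed

text \<open>Expand \<open>d\<close> in the rows \<open>p, q, E\<close> by Cramer's rule and apply the linear form
  \<open>v \<mapsto> bracket (v # e # E)\<close>, which vanishes on \<open>E\<close>.\<close>

lemma plucker:
  fixes p q d e :: "nat \<Rightarrow> 'a::comm_ring_1"
  shows "bracket (p # q # E) * bracket (d # e # E)
    = bracket (d # q # E) * bracket (p # e # E) + bracket (p # d # E) * bracket (q # e # E)"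
proof -
  let ?vs = "p # q # E" and ?n = "Suc (Suc (length E))"
  obtain K where K: "\<And>v. bracket (v # e # E) = (\<Sum>j<?n. v j * K j)"
    using bracket_Cons_linear[of "e # E"] by auto
  have vanish: "bracket ((?vs ! i) # e # E) = 0" if "i \<in> {..<?n} - {0, 1}" for i
  proof -
    have "?vs ! i \<in> set E" using that by (cases i; cases "i - 1") auto
    thus ?thesis by (intro bracket_not_distinct) auto
  qed
  have "bracket ?vs * bracket (d # e # E) = (\<Sum>j<?n. (bracket ?vs * d j) * K j)"
    by (simp only: K sum_distrib_left mult.assoc)
  also have "\<dots> = (\<Sum>j<?n. (\<Sum>i<?n. bracket (?vs[i := d]) * (?vs ! i) j) * K j)"
    using cramer_rows[of _ ?vs d] by (intro sum.cong refl) simp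
  also have "\<dots> = (\<Sum>i<?n. bracket (?vs[i := d]) * bracket ((?vs ! i) # e # E))"
    unfolding K sum_distrib_left sum_distrib_right mult.assoc by (rule sum.swap)
  also have "\<dots> = (\<Sum>i\<in>{0, 1}. bracket (?vs[i := d]) * bracket ((?vs ! i) # e # E))"
    by (rule sum.mono_neutral_right) (use vanish in auto)
  finally show ?thesis by simp
qed

subsection \<open>Maximal minors of Hankel matrices\<close>

definition hankel_row :: "nat \<Rightarrow> nat \<Rightarrow> 'k::field mpoly" where
  "hankel_row c j = var (c + j)"

text \<open>The maximal minors of a Hankel matrix with \<open>card C\<close> columns;
  \<open>C\<close> is the set of chosen rows, each labelled by the index of its first entry.\<close>

definition hankel_det :: "nat set \<Rightarrow> 'k::field mpoly" where
  "hankel_det C = bracket (map hankel_row (sorted_list_of_set C))"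

lemma bracket_hankel_row:
  assumes "distinct cs"
  shows "bracket (map hankel_row cs) \<in> {hankel_det (set cs), - hankel_det (set cs) :: 'k::field mpoly}"
proof -
  have "mset cs = mset (sorted_list_of_set (set cs))"
    using assms by (simp add: sorted_list_of_set_sort_remdups distinct_remdups_id)
  hence "mset (map hankel_row cs) = mset (map (hankel_row :: nat \<Rightarrow> nat \<Rightarrow> 'k mpoly) (sorted_list_of_set (set cs)))"
    by (simp only: mset_map)
  thus ?thesis
    unfolding hankel_det_def using bracket_mset by blast
qed

definition unit_row :: "nat \<Rightarrow> nat \<Rightarrow> 'a::comm_ring_1" where
  "unit_row l j = (if j = l then 1 else 0)"

text \<open>Expansion along the unit row deletes the first column, so every remaining row starts one
  index later.\<close>

lemma bracket_first_unit:
  "(bracket (unit_row 0 # map hankel_row cs) :: 'k::field mpoly) = bracket (map hankel_row (map Suc cs))"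
proof -
  let ?n = "length cs"
  define M :: "'k mpoly mat" where "M = mat (Suc ?n) (Suc ?n) (\<lambda>(i, j). ((unit_row 0 # map hankel_row cs) ! i) j)"
  have "(bracket (unit_row 0 # map hankel_row cs) :: 'k mpoly) = (\<Sum>j<Suc ?n. M $$ (0, j) * cofactor M 0 j)"
    using laplace_expansion_row[of M "Suc ?n" 0] by (simp add: bracket_def M_def)
  also have "\<dots> = (\<Sum>j\<in>{0}. M $$ (0, j) * cofactor M 0 j)"
    by (rule sum.mono_neutral_right) (auto simp: M_def unit_row_def)
  also have "\<dots> = det (mat_delete M 0 0)"
    by (simp add: M_def unit_row_def cofactor_def)
  also have "mat_delete M 0 0 = mat ?n ?n (\<lambda>(i, j). (map hankel_row (map Suc cs) ! i) j)"
    by (rule eq_matI) (auto simp: mat_delete_def M_def hankel_row_def)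
  finally show ?thesis by (simp add: bracket_def)
qed

text \<open>Expansion along the unit row deletes the last column, so the remaining rows keep their
  labels and the size drops by one.\<close>

lemma bracket_last_unit:
  "(bracket (unit_row (length cs) # map hankel_row cs) :: 'k::field mpoly) = (- 1) ^ length cs * bracket (map hankel_row cs)"
proof -
  let ?n = "length cs"
  define M :: "'k mpoly mat" where "M = mat (Suc ?n) (Suc ?n) (\<lambda>(i, j). ((unit_row ?n # map hankel_row cs) ! i) j)"
  have "(bracket (unit_row ?n # map hankel_row cs) :: 'k mpoly) = (\<Sum>j<Suc ?n. M $$ (0, j) * cofactor M 0 j)"
    using laplace_expansion_row[of M "Suc ?n" 0] by (simp add: bracket_def M_def)
  also have "\<dots> = (\<Sum>j\<in>{?n}. M $$ (0, j) * cofactor M 0 j)"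
    by (rule sum.mono_neutral_right) (auto simp: M_def unit_row_def)
  also have "\<dots> = (- 1) ^ ?n * det (mat_delete M 0 ?n)"
    by (simp add: M_def unit_row_def cofactor_def)
  also have "mat_delete M 0 ?n = mat ?n ?n (\<lambda>(i, j). (map hankel_row cs ! i) j)"
    by (rule eq_matI) (auto simp: mat_delete_def M_def)
  finally show ?thesis by (simp add: bracket_def)
qed

lemma bracket_polyS:
  assumes "\<And>v j. v \<in> set vs \<Longrightarrow> j < length vs \<Longrightarrow> v j \<in> polyS n"
  shows "bracket vs \<in> polyS n"
  unfolding bracket_def by (rule det_polyS) (use assms in auto)

lemma hankel_row_polyS: "1 \<le> c \<Longrightarrow> c + j \<le> n \<Longrightarrow> hankel_row c j \<in> polyS n"
  by (simp add: hankel_row_def var_polyS)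

lemma hankel_det_polyS:
  assumes "finite C" "\<And>c. c \<in> C \<Longrightarrow> 1 \<le> c \<and> c + card C \<le> Suc n"
  shows "hankel_det C \<in> polyS n"
  unfolding hankel_det_def
  by (rule bracket_polyS) (use assms in \<open>force intro!: hankel_row_polyS\<close>)

lemma ideal_cong_sign:
  assumes "is_idealS n I" "x \<in> {y, - y}"
  shows "x \<in> I \<longleftrightarrow> y \<in> I"
  using assms(2) is_idealS_uminus[OF assms(1), of y] is_idealS_uminus[OF assms(1), of "- y"] by auto

lemma mult_sign: "x \<in> {y, - y} \<Longrightarrow> x' \<in> {y', - y'} \<Longrightarrow> x * x' \<in> {y * y', - (y * y' :: 'a::comm_ring_1)}"
  by auto

lemma sign_trans: "x \<in> {y, - y} \<Longrightarrow> y \<in> {z, - z} \<Longrightarrow> x \<in> {z, - z :: 'a::comm_ring_1}"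
  by auto

lemma minus_one_power_mult: "(- 1) ^ k * x \<in> {x, - x :: 'a::comm_ring_1}"
  by (cases "even k") auto

lemma bracket_first_unit_sign:
  assumes "distinct cs"
  shows "bracket (unit_row 0 # map hankel_row cs) \<in> {hankel_det (Suc ` set cs), - hankel_det (Suc ` set cs) :: 'k::field mpoly}"
  unfolding bracket_first_unit using bracket_hankel_row[of "map Suc cs"] assms
  by (simp add: distinct_map)

lemma bracket_last_unit_sign:
  assumes "distinct cs"
  shows "bracket (unit_row (length cs) # map hankel_row cs) \<in> {hankel_det (set cs), - hankel_det (set cs) :: 'k::field mpoly}"
  unfolding bracket_last_unit by (rule sign_trans[OF minus_one_power_mult bracket_hankel_row[OF assms]])

text \<open>The relation \<open>plucker\<close> with a unit row for \<open>d\<close>: on its right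
  side one factor of each product is a given element of \<open>I\<close>. The first unit row yields
  the shifted multiplier, the last one the unshifted multiplier.\<close>

lemma hankel_det_exchange:
  fixes I :: "'k::field mpoly set"
  assumes I: "is_idealS n I" and E: "finite E" and dist: "p \<notin> E" "q \<notin> E" "e \<notin> E" "p \<noteq> q" "p \<noteq> e" "q \<noteq> e"
    and bd: "\<And>c. c \<in> {p, q, e} \<union> E \<Longrightarrow> 1 \<le> c \<and> c + card E + 1 \<le> n"
    and pe: "hankel_det (insert p (insert e E)) \<in> I"
    and qe: "hankel_det (insert q (insert e E)) \<in> I"
  shows "hankel_det (insert p (insert q E)) * hankel_det (Suc ` insert e E) \<in> I" (is ?A)
    and "hankel_det (insert p (insert q E)) * hankel_det (insert e E) \<in> I" (is ?B)
proof -
  let ?h = "hankel_row :: nat \<Rightarrow> nat \<Rightarrow> 'k mpoly"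
  define ls where "ls = sorted_list_of_set E"
  have ls: "set ls = E" "distinct ls" "length ls = card E" using E by (auto simp: ls_def)
  have br: "bracket (map ?h (a # b # ls)) \<in> {hankel_det (insert a (insert b E)), - hankel_det (insert a (insert b E))}"
    if "a \<notin> E" "b \<notin> E" "a \<noteq> b" for a b
    using bracket_hankel_row[of "a # b # ls"] that ls by simp
  have key: "hankel_det (insert p (insert q E)) * x \<in> I"
    if x: "bracket (d # ?h e # map ?h ls) \<in> {x, - x}" and d: "\<And>j. d j \<in> polyS n" for d x
  proof -
    have row: "?h c j \<in> polyS n" if "c \<in> {p, q, e} \<union> E" "j < card E + 2" for c j
      using bd[OF that(1)] that(2) by (intro hankel_row_polyS) auto
    have 1: "bracket (d # ?h q # map ?h ls) \<in> polyS n" "bracket (?h p # d # map ?h ls) \<in> polyS n"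
      using d row by (auto intro!: bracket_polyS simp: ls)
    have "bracket (?h p # ?h e # map ?h ls) \<in> I" "bracket (?h q # ?h e # map ?h ls) \<in> I"
      using ideal_cong_sign[OF I br[of p e]] ideal_cong_sign[OF I br[of q e]] pe qe dist by auto
    hence "bracket (?h p # ?h q # map ?h ls) * bracket (d # ?h e # map ?h ls) \<in> I"
      unfolding plucker[of "?h p" "?h q" _ d "?h e"]
      by (intro is_idealS_add[OF I] is_idealS_mult[OF I] 1)
    moreover have "bracket (?h p # ?h q # map ?h ls) * bracket (d # ?h e # map ?h ls)
      \<in> {hankel_det (insert p (insert q E)) * x, - (hankel_det (insert p (insert q E)) * x)}"
      by (rule mult_sign[OF _ x]) (use br[of p q] dist in simp)
    ultimately show ?thesis using ideal_cong_sign[OF I] by blast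
  qed
  show ?A
  proof (rule key)
    show "bracket (unit_row 0 # ?h e # map ?h ls) \<in> {hankel_det (Suc ` insert e E), - hankel_det (Suc ` insert e E)}"
      using bracket_first_unit_sign[of "e # ls"] ls dist by simp
  qed (simp add: unit_row_def)
  show ?B
  proof (rule key)
    show "bracket (unit_row (Suc (card E)) # ?h e # map ?h ls) \<in> {hankel_det (insert e E), - hankel_det (insert e E)}"
      using bracket_last_unit_sign[of "e # ls"] ls dist by simp
  qed (simp add: unit_row_def)
qed

text \<open>The relation \<open>plucker\<close> with the first unit row for \<open>d\<close> and the
  last one for \<open>e\<close>. Its left side lies in \<open>I\<close>, so the two products on the
  right agree modulo \<open>I\<close> up to sign.\<close>

lemma hankel_det_shift:
  fixes I :: "'k::field mpoly set"
  assumes I: "is_idealS n I" and E: "finite E" and dist: "p \<notin> E" "q \<notin> E" "p \<noteq> q"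
    and bd: "\<And>c. c \<in> {p, q} \<union> E \<Longrightarrow> 1 \<le> c \<and> c + card E + 1 \<le> n"
    and pq: "hankel_det (insert p (insert q E)) \<in> I"
  shows "hankel_det (Suc ` insert p E) * hankel_det (insert q E) \<in> I
    \<longleftrightarrow> hankel_det (Suc ` insert q E) * hankel_det (insert p E) \<in> I"
proof -
  let ?h = "hankel_row :: nat \<Rightarrow> nat \<Rightarrow> 'k mpoly"
  define ls where "ls = sorted_list_of_set E"
  have ls: "set ls = E" "distinct ls" "length ls = card E" using E by (auto simp: ls_def)
  let ?u = "unit_row 0 :: nat \<Rightarrow> 'k mpoly" and ?w = "unit_row (Suc (card E)) :: nat \<Rightarrow> 'k mpoly"
  let ?ls = "map ?h ls"
  have u: "bracket (?u # ?h a # ?ls) \<in> {hankel_det (Suc ` insert a E), - hankel_det (Suc ` insert a E)}"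
    if "a \<notin> E" for a
    using bracket_first_unit_sign[of "a # ls"] ls that by simp
  have u': "bracket (?h a # ?u # ?ls) \<in> {hankel_det (Suc ` insert a E), - hankel_det (Suc ` insert a E)}"
    if "a \<notin> E" for a
    by (rule sign_trans[OF _ u[OF that]]) (use bracket_mset[of "?h a # ?u # ?ls" "?u # ?h a # ?ls"] in simp)
  have w: "bracket (?h a # ?w # ?ls) \<in> {hankel_det (insert a E), - hankel_det (insert a E)}" if "a \<notin> E" for a
  proof (rule sign_trans)
    show "bracket (?w # ?h a # ?ls) \<in> {hankel_det (insert a E), - hankel_det (insert a E)}"
      using bracket_last_unit_sign[of "a # ls"] ls that by simp
  qed (use bracket_mset[of "?h a # ?w # ?ls" "?w # ?h a # ?ls"] in simp)
  have row: "?h c j \<in> polyS n" if "c \<in> {p, q} \<union> E" "j < card E + 2" for c j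
    using bd[OF that(1)] that(2) by (intro hankel_row_polyS) auto
  have 1: "bracket (?u # ?w # ?ls) \<in> polyS n"
    using row by (auto intro!: bracket_polyS simp: ls unit_row_def)
  have "bracket (?h p # ?h q # ?ls) \<in> {hankel_det (insert p (insert q E)), - hankel_det (insert p (insert q E))}"
    using bracket_hankel_row[of "p # q # ls"] dist ls by simp
  hence "bracket (?h p # ?h q # ?ls) \<in> I"
    using ideal_cong_sign[OF I] pq by blast
  hence "bracket (?h p # ?h q # ?ls) * bracket (?u # ?w # ?ls) \<in> I"
    using is_idealS_mult[OF I _ 1] by (simp add: mult.commute)
  hence sum: "bracket (?u # ?h q # ?ls) * bracket (?h p # ?w # ?ls)
      + bracket (?h p # ?u # ?ls) * bracket (?h q # ?w # ?ls) \<in> I"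
    using plucker[of "?h p" "?h q" ?ls ?u ?w] by simp
  have "a \<in> I \<longleftrightarrow> b \<in> I" if "a + b \<in> I" for a b
    using is_idealS_diff[OF I that, of a] is_idealS_diff[OF I that, of b] by auto
  from this[OF sum] show ?thesis
    using ideal_cong_sign[OF I mult_sign[OF u[of q] w[of p]]] ideal_cong_sign[OF I mult_sign[OF u'[of p] w[of q]]] dist
    by simp
qed

subsection \<open>Leading monomials\<close>

text \<open>Strict convexity in \<open>i\<close> singles out main diagonals. The factor
  \<open>N\<close>, later \<open>n - 1\<close>, keeps the matching parameter weights
  \<open>tw\<close> integral.\<close>

definition sqw :: "nat \<Rightarrow> nat \<Rightarrow> int" where
  "sqw N i = int N * (int i)\<^sup>2"

text \<open>Undoing an inversion i < j of \<open>p\<close> raises the sum by 2 (e j - e i)(d (p i) -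
  d (p j)) > 0, so no permutation other than the identity can be a maximizer.\<close>

lemma rearrangement_strict:
  fixes e d :: "nat \<Rightarrow> int"
  assumes e: "\<And>i j. i < j \<Longrightarrow> j < t \<Longrightarrow> e i < e j" and d: "\<And>i j. i < j \<Longrightarrow> j < t \<Longrightarrow> d i < d j"
    and p: "p permutes {..<t}" and "p \<noteq> id"
  shows "(\<Sum>i<t. (e i + d (p i))\<^sup>2) < (\<Sum>i<t. (e i + d i)\<^sup>2)"
proof -
  define S where "S p = (\<Sum>i<t. (e i + d (p i))\<^sup>2)" for p
  have step: "\<exists>q. q permutes {..<t} \<and> S p < S q" if p: "p permutes {..<t}" and "p \<noteq> id" for p
  proof -
    have "\<exists>i j. i < j \<and> j < t \<and> p j < p i"
    proof (rule ccontr)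
      assume "\<not> ?thesis"
      hence mono: "p i \<le> p j" if "i < j" "j < t" for i j using that by (meson not_le)
      have less: "p i < p j" if "i < j" "j < t" for i j
        using mono[OF that] inj_eq[OF permutes_inj[OF p], of i j] that by auto
      \<comment> \<open>Without inversions \<open>p\<close> is increasing and dominates the identity
        pointwise; a strict inequality anywhere contradicts the invariance of the sum of all
        indices.\<close>
      have ge: "i \<le> p i" if "i < t" for i
        using that
      proof (induction i)
        case (Suc i)
        hence "i \<le> p i" "p i < p (Suc i)" using less[of i "Suc i"] by simp_all
        thus ?case by simp
      qed simp
      obtain i where "p i \<noteq> i" using \<open>p \<noteq> id\<close> by fastforce
      hence "i < t" "i < p i" using permutes_not_in[OF p, of i] ge[of i] by fastforce+
      hence "(\<Sum>i<t. i) < (\<Sum>i<t. p i)" using ge by (intro sum_strict_mono_ex1) auto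
      thus False using sum.permute[OF p, of "\<lambda>i. i"] by simp
    qed
    then obtain i j where ij: "i < j" "j < t" "p j < p i" by blast
    define q where "q = p \<circ> transpose i j"
    have "q permutes {..<t}"
      unfolding q_def using ij by (intro permutes_compose[OF permutes_swap_id p]) auto
    have pt: "p i < t" using permutes_in_image[OF p, of i] ij by simp
    have "S r = (\<Sum>k\<in>{..<t} - {i, j}. (e k + d (r k))\<^sup>2) + (e i + d (r i))\<^sup>2 + (e j + d (r j))\<^sup>2" for r
    proof -
      have "S r = (\<Sum>k\<in>{..<t} - {i, j}. (e k + d (r k))\<^sup>2) + (\<Sum>k\<in>{i, j}. (e k + d (r k))\<^sup>2)"
        unfolding S_def using ij by (intro sum.subset_diff) auto
      thus ?thesis using ij by simp
    qed
    moreover have "(\<Sum>k\<in>{..<t} - {i, j}. (e k + d (q k))\<^sup>2) = (\<Sum>k\<in>{..<t} - {i, j}. (e k + d (p k))\<^sup>2)"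
      by (intro sum.cong) (auto simp: q_def transpose_def)
    moreover have "q i = p j" "q j = p i" by (auto simp: q_def)
    moreover have "0 < (e j - e i) * (d (p i) - d (p j))"
      using e[OF ij(1,2)] d[OF ij(3) pt] by simp
    ultimately have "S p < S q" by (simp add: power2_eq_square algebra_simps)
    thus ?thesis using \<open>q permutes {..<t}\<close> by blast
  qed
  \<comment> \<open>Among finitely many permutations a maximizer exists, and by \<open>step\<close>
    it is the identity; \<open>p\<close> is strictly below some value and hence below the
    maximum.\<close>
  let ?P = "{p. p permutes {..<t}}"
  have fin: "finite (S ` ?P)" by (intro finite_imageI finite_permutations) auto
  have "Max (S ` ?P) \<in> S ` ?P" using permutes_id[of "{..<t}"] by (intro Max_in[OF fin]) blast
  then obtain m where m: "m permutes {..<t}" "S m = Max (S ` ?P)" by auto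
  have max: "S q \<le> S m" if "q permutes {..<t}" for q
    using that m(2) fin by auto
  have "m = id" using step[OF m(1)] max by force
  obtain q where "q permutes {..<t}" "S p < S q" using step[OF p \<open>p \<noteq> id\<close>] by blast
  hence "S p < S m" using max by force
  thus ?thesis using \<open>m = id\<close> by (simp add: S_def)
qed

lemma prod_var: "finite A \<Longrightarrow> (\<Prod>i\<in>A. var (f i)) = single (\<Sum>i\<in>A. single (f i) 1) 1"
  by (induction A rule: finite_induct) (simp_all add: var_def mult_single)

text \<open>In the Leibniz expansion the identity gives the main diagonal; by
  \<open>rearrangement_strict\<close> every other permutation gives a monomial of smaller
  weight.\<close>

lemma top_form_det:
  fixes e d :: "nat \<Rightarrow> nat"
  assumes N: "N > 0"
    and e: "\<And>i j. i < j \<Longrightarrow> j < t \<Longrightarrow> e i < e j" and d: "\<And>i j. i < j \<Longrightarrow> j < t \<Longrightarrow> d i < d j"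
  shows "top_form (sqw N) (\<Sum>i<t. sqw N (e i + d i)) 1 (\<Sum>i<t. single (e i + d i) 1)
    (det (mat t t (\<lambda>(i, j). var (e i + d j))) :: 'k::field mpoly)"
proof -
  let ?P = "{p. p permutes {0..<t}}"
  let ?m = "\<lambda>p. \<Sum>i<t. single (e i + d (p i)) (1::nat)"
  let ?r = "\<Sum>p\<in>?P - {id}. signof p * single (?m p) 1 :: 'k mpoly"
  have "det (mat t t (\<lambda>(i, j). var (e i + d j)) :: 'k mpoly mat)
      = (\<Sum>p\<in>?P. signof p * (\<Prod>i = 0..<t. var (e i + d (p i))))"
    by (subst det_def'[of _ t])
       (auto intro!: sum.cong prod.cong simp: permutes_in_image[of _ "{0..<t}", simplified])
  also have "\<dots> = (\<Sum>p\<in>?P. signof p * single (?m p) 1)"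
    by (simp add: prod_var atLeast0LessThan)
  also have "\<dots> = signof id * single (?m id) 1 + ?r"
    by (rule sum.remove) (auto simp: permutes_id finite_permutations)
  finally have eq: "det (mat t t (\<lambda>(i, j). var (e i + d j)) :: 'k mpoly mat) = single (\<Sum>i<t. single (e i + d i) 1) 1 + ?r"
    by (simp add: sign_id)
  show ?thesis
  proof (rule top_formI[OF eq])
    show "weight (sqw N) (\<Sum>i<t. single (e i + d i) 1) = (\<Sum>i<t. sqw N (e i + d i))"
      by (simp add: weight_sum)
    fix \<nu> assume "\<nu> \<in> keys ?r"
    then obtain p where p: "p \<in> ?P - {id}" "\<nu> \<in> keys (signof p * single (?m p) 1 :: 'k mpoly)"
      using Poly_Mapping.keys_sum[of "\<lambda>p. signof p * single (?m p) 1 :: 'k mpoly" "?P - {id}"] by blast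
    have "\<nu> = ?m p"
      using p(2) by (auto simp: sign_def split: if_splits)
    hence "weight (sqw N) \<nu> = int N * (\<Sum>i<t. (int (e i) + int (d (p i)))\<^sup>2)"
      by (simp add: weight_sum sqw_def sum_distrib_left)
    also have "\<dots> < int N * (\<Sum>i<t. (int (e i) + int (d i))\<^sup>2)"
      using rearrangement_strict[of t "\<lambda>i. int (e i)" "\<lambda>i. int (d i)" p] N e d p(1)
      by (simp add: atLeast0LessThan)
    finally show "weight (sqw N) \<nu> < (\<Sum>i<t. sqw N (e i + d i))"
      by (simp add: sqw_def sum_distrib_left)
  qed
qed

lemma top_form_hankel_det:
  assumes "finite C" "N > 0"
  defines "a \<equiv> (\<lambda>i. sorted_list_of_set C ! i + i)"
  shows "top_form (sqw N) (\<Sum>i<card C. sqw N (a i)) 1 (\<Sum>i<card C. single (a i) 1) (hankel_det C :: 'k::field mpoly)"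
proof -
  let ?cs = "sorted_list_of_set C"
  have "(hankel_det C :: 'k mpoly) = det (mat (card C) (card C) (\<lambda>(i, j). var (?cs ! i + j)))"
    unfolding hankel_det_def bracket_def
    by (intro arg_cong[where f = det] eq_matI) (auto simp: hankel_row_def assms(1))
  moreover have "?cs ! i < ?cs ! j" if "i < j" "j < card C" for i j
    using sorted_wrt_nth_less[OF strict_sorted_list_of_set[of C], of i j] that assms(1) by simp
  ultimately show ?thesis
    unfolding a_def using top_form_det[of N "card C" "\<lambda>i. ?cs ! i" "\<lambda>j. j"] \<open>N > 0\<close> by simp
qed

subsection \<open>Secant varieties of the rational normal curve\<close>

text \<open>Generic sum of points of the rational normal curve; point \<open>j\<close> has homogeneous
  parameters \<open>var (2 * j)\<close>, \<open>var (2 * j + 1)\<close>, replaced by \<open>0\<close> if \<open>j \<notin> P\<close> and \<open>j \<notin> R\<close>, respectively.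
  So \<open>j \<in> P - R\<close> and \<open>j \<in> R - P\<close> give the coordinate points for \<open>x\<^sub>1\<close> and \<open>x\<^sub>n\<close>.\<close>

definition secant :: "nat \<Rightarrow> nat set \<Rightarrow> nat set \<Rightarrow> nat \<Rightarrow> 'k::field mpoly" where
  "secant n P R i = (\<Sum>j<n + 2. (if j \<in> P then var (2 * j) else 0) ^ (n - i) * (if j \<in> R then var (2 * j + 1) else 0) ^ (i - 1))"

text \<open>Relabelling points by \<pi> and setting some parameters to 0 specializes the generic sum
  of one configuration to that of the other. A polynomial killed by the first substitution is
  therefore killed by the second.\<close>

lemma subst_secant_mono:
  assumes \<pi>: "\<pi> permutes {..<n + 2}"
    and P: "\<And>j. j < n + 2 \<Longrightarrow> \<pi> j \<in> P' \<Longrightarrow> j \<in> P"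
    and R: "\<And>j. j < n + 2 \<Longrightarrow> \<pi> j \<in> R' \<Longrightarrow> j \<in> R"
    and F: "subst (secant n P R) F = 0"
  shows "subst (secant n P' R') F = 0"
proof -
  define U V where "U j = (if j \<in> P' then var (2 * j) else 0 :: 'a mpoly)"
    and "V j = (if j \<in> R' then var (2 * j + 1) else 0 :: 'a mpoly)" for j
  define w where "w i = (if even i then U (\<pi> (i div 2)) else V (\<pi> (i div 2)))" for i
  have "subst w (secant n P R i) = secant n P' R' i" for i
  proof -
    have 1: "subst w (if j \<in> P then var (2 * j) else 0) = U (\<pi> j)" if "j < n + 2" for j
      using P[OF that] by (auto simp: w_def U_def)
    have 2: "subst w (if j \<in> R then var (2 * j + 1) else 0) = V (\<pi> j)" if "j < n + 2" for j
      using R[OF that] by (auto simp: w_def V_def)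
    have "subst w (secant n P R i) = (\<Sum>j<n + 2. U (\<pi> j) ^ (n - i) * V (\<pi> j) ^ (i - 1))"
      unfolding secant_def subst_sum subst_mult subst_power
      by (intro sum.cong refl) (simp only: 1 2 lessThan_iff)
    also have "\<dots> = (\<Sum>j<n + 2. U j ^ (n - i) * V j ^ (i - 1))"
      using sum.permute[OF \<pi>, of "\<lambda>j. U j ^ (n - i) * V j ^ (i - 1)"] by (simp add: o_def)
    finally show ?thesis by (simp add: secant_def U_def V_def)
  qed
  hence "subst (secant n P' R') F = subst w (subst (secant n P R) F)"
    by (simp add: subst_subst)
  thus ?thesis by (simp add: F)
qed

section \<open>Parameter weights taken from chords of the parabola\<close>

locale tangent_weights =
  fixes n :: nat and P R :: "nat set" and p :: "nat \<Rightarrow> nat"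
  assumes n: "n \<ge> 2"
    and separated: "\<And>i j. i < n + 2 \<Longrightarrow> j < n + 2 \<Longrightarrow> i \<in> P \<union> R \<Longrightarrow> j \<in> P \<union> R \<Longrightarrow> i \<noteq> j
      \<Longrightarrow> p i + 1 < p j \<or> p j + 1 < p i"
begin

text \<open>Nonvanishing of coordinate \<open>i\<close> of point \<open>j\<close>, for i in 1..n: a
  parameter set to 0 survives only with exponent 0.\<close>

definition active :: "nat \<Rightarrow> nat \<Rightarrow> bool" where
  "active j i \<longleftrightarrow> (j \<in> P \<or> i = n) \<and> (j \<in> R \<or> i = 1)"

text \<open>Point \<open>j\<close> accounts for the two consecutive indices at which its chord meets
  the parabola; \<open>separated\<close> makes these pairs disjoint.\<close>

definition covers :: "nat \<Rightarrow> nat \<Rightarrow> bool" where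
  "covers j i \<longleftrightarrow> j < n + 2 \<and> (i = p j \<or> i = Suc (p j)) \<and> active j i"

definition covered :: "nat set" where
  "covered = {i \<in> {1..n}. \<exists>j. covers j i}"

text \<open>Unique on \<open>covered\<close>, since the pairs are disjoint. Elsewhere it is
  arbitrary, and \<open>top_form_secant\<close> attaches coefficient 0 to it.\<close>

definition pt :: "nat \<Rightarrow> nat" where
  "pt i = (SOME j. covers j i)"

definition term_monomial :: "nat \<Rightarrow> nat \<Rightarrow> (nat \<Rightarrow>\<^sub>0 nat)" where
  "term_monomial j i = single (2 * j) (n - i) + single (2 * j + 1) (i - 1)"

text \<open>On the monomial of point \<open>j\<close> at \<open>i\<close>, this weight takes \<open>n - 1\<close> times the value at \<open>i\<close> of the
  secant line of \<open>x\<^sup>2\<close> through \<open>p j\<close> and \<open>p j + 1\<close>.\<close>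

definition tw :: "nat \<Rightarrow> int" where
  "tw x = (let q = int (p (x div 2)) in (if even x then 1 else int n) * (2 * q + 1) - q * (q + 1))"

text \<open>The two parameters carry the values of the chord at 1 and at n, so the monomial at
  \<open>i\<close> has n - 1 times the chord value at \<open>i\<close>. The parabola minus its chord
  through q and q + 1 is (i - q)(i - q - 1).\<close>

lemma weight_term_monomial:
  assumes "1 \<le> i" "i \<le> n"
  shows "weight tw (term_monomial j i) = sqw (n - 1) i - int (n - 1) * ((int i - int (p j)) * (int i - int (p j) - 1))"
proof -
  have "int (n - i) = int n - int i" "int (i - 1) = int i - 1" "int (n - 1) = int n - 1"
    using assms n by auto
  thus ?thesis
    by (simp add: term_monomial_def tw_def Let_def sqw_def power2_eq_square algebra_simps)
qed

lemma consecutive_product_pos: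
  assumes "i \<noteq> q" "i \<noteq> Suc q"
  shows "0 < (int i - int q) * (int i - int q - 1)"
proof (cases "i < q")
  case True
  thus ?thesis by (intro mult_neg_neg) auto
next
  case False
  thus ?thesis using assms by (intro mult_pos_pos) auto
qed

lemma covers_unique:
  assumes "covers j i" "j' < n + 2" "active j' i" "j' \<noteq> j"
  shows "i \<noteq> p j'" "i \<noteq> Suc (p j')"
proof -
  have act: "l \<in> P \<union> R" if "active l i" for l
    using that n by (auto simp: active_def)
  have "p j' + 1 < p j \<or> p j + 1 < p j'"
    using separated[of j' j] assms act by (auto simp: covers_def)
  thus "i \<noteq> p j'" "i \<noteq> Suc (p j')"
    using assms(1) by (auto simp: covers_def)
qed

lemma covers_pt: "i \<in> covered \<Longrightarrow> covers (pt i) i"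
  unfolding covered_def pt_def by (auto intro: someI)

lemma secant_terms:
  assumes i: "1 \<le> i" "i \<le> n"
  shows "secant n P R i = (\<Sum>j<n + 2. single (term_monomial j i) (if active j i then 1 else 0) :: 'k::field mpoly)"
  unfolding secant_def
proof (intro sum.cong refl)
  fix j
  have pow: "(var x :: 'k mpoly) ^ k = single (single x k) 1" for x k
    by (induction k) (simp_all add: var_def mult_single flip: single_add)
  show "(if j \<in> P then var (2 * j) else 0) ^ (n - i) * (if j \<in> R then var (2 * j + 1) else 0) ^ (i - 1)
      = (single (term_monomial j i) (if active j i then 1 else 0) :: 'k mpoly)"
    using i n unfolding active_def term_monomial_def
    by (cases "i = 1"; cases "i = n") (auto simp: pow mult_single zero_power)
qed

text \<open>At integers a chord lies below the parabola except at its two end points. Only the term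
  of the covering point, if there is one, attains the weight of the parabola.\<close>

lemma top_form_secant:
  assumes i: "1 \<le> i" "i \<le> n"
  shows "top_form tw (sqw (n - 1) i) (if i \<in> covered then 1 else 0) (term_monomial (pt i) i) (secant n P R i :: 'k::field mpoly)"
proof -
  let ?t = "\<lambda>j. single (term_monomial j i) (if active j i then 1 else 0) :: 'k mpoly"
  let ?J = "if i \<in> covered then {..<n + 2} - {pt i} else {..<n + 2}"
  show ?thesis
  proof (rule top_formI)
    show "secant n P R i = single (term_monomial (pt i) i) (if i \<in> covered then 1 else 0) + (\<Sum>j\<in>?J. ?t j)"
    proof (cases "i \<in> covered")
      case True
      hence "pt i < n + 2" "active (pt i) i" using covers_pt by (auto simp: covers_def)
      hence "(\<Sum>j<n + 2. ?t j) = single (term_monomial (pt i) i) 1 + (\<Sum>j\<in>{..<n + 2} - {pt i}. ?t j)"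
        using sum.remove[of "{..<n + 2}" "pt i" ?t] by (simp only: finite_lessThan lessThan_iff if_True)
      thus ?thesis using True by (simp only: secant_terms[OF i] if_True)
    next
      case False
      thus ?thesis by (simp add: secant_terms[OF i])
    qed
    show "weight tw (term_monomial (pt i) i) = sqw (n - 1) i" if "(if i \<in> covered then 1 else 0 :: 'k) \<noteq> 0"
    proof -
      have "i = p (pt i) \<or> i = Suc (p (pt i))"
        using that covers_pt by (auto simp: covers_def split: if_splits)
      thus ?thesis by (auto simp: weight_term_monomial[OF i])
    qed
    fix \<nu> assume "\<nu> \<in> keys (\<Sum>j\<in>?J. ?t j)"
    then obtain j where "j \<in> ?J" "\<nu> \<in> keys (?t j)"
      using Poly_Mapping.keys_sum[of ?t ?J] by blast
    hence j: "j < n + 2" "i \<in> covered \<longrightarrow> j \<noteq> pt i" "active j i" "\<nu> = term_monomial j i"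
      by (auto split: if_splits)
    have "i \<noteq> p j \<and> i \<noteq> Suc (p j)"
    proof (cases "i \<in> covered")
      case True
      thus ?thesis using covers_unique[OF covers_pt[OF True] j(1,3)] j(2) by blast
    next
      case False
      thus ?thesis using i j by (auto simp: covered_def covers_def)
    qed
    hence pos: "0 < (int i - int (p j)) * (int i - int (p j) - 1)"
      using consecutive_product_pos by blast
    have "0 < int (n - 1) * ((int i - int (p j)) * (int i - int (p j) - 1))"
      by (rule mult_pos_pos[OF _ pos]) (use n in simp)
    thus "weight tw \<nu> < sqw (n - 1) i"
      unfolding j(4) weight_term_monomial[OF i] by linarith
  qed
qed

text \<open>\<open>c\<close> is the other index of the pair containing \<open>i\<close>. The
  monomial of index k has parameter exponents n - k and k - 1, on which the linear form with
  coefficients 1 - c and n - c takes the value (n - 1)(k - c). It kills the contribution of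
  \<open>c\<close> and thus isolates the exponent of \<open>i\<close>.\<close>

lemma lookup_image_covered:
  assumes \<mu>: "keys \<mu> \<subseteq> covered" and i: "i \<in> covered"
    and c: "{i, c} = {p (pt i), Suc (p (pt i))}"
  shows "(1 - int c) * int (lookup (image_monomial (\<lambda>i. term_monomial (pt i) i) \<mu>) (2 * pt i))
    + (int n - int c) * int (lookup (image_monomial (\<lambda>i. term_monomial (pt i) i) \<mu>) (2 * pt i + 1))
    = int (lookup \<mu> i) * (int (n - 1) * (int i - int c))"
proof -
  let ?h = "\<lambda>i. term_monomial (pt i) i" and ?j = "pt i"
  have h0: "lookup (?h k) (2 * ?j) = (if pt k = ?j then n - k else 0)" for k
    by (simp add: term_monomial_def lookup_add lookup_single when_def) presburger
  have h1: "lookup (?h k) (2 * ?j + 1) = (if pt k = ?j then k - 1 else 0)" for k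
    by (simp add: term_monomial_def lookup_add lookup_single when_def)
  have "(1 - int c) * int (lookup (image_monomial ?h \<mu>) (2 * ?j)) + (int n - int c) * int (lookup (image_monomial ?h \<mu>) (2 * ?j + 1))
     = (\<Sum>k\<in>keys \<mu>. int (lookup \<mu> k) * ((1 - int c) * int (lookup (?h k) (2 * ?j)) + (int n - int c) * int (lookup (?h k) (2 * ?j + 1))))"
    unfolding lookup_image_monomial of_nat_sum sum_distrib_left sum.distrib[symmetric]
    by (intro sum.cong refl) (simp add: algebra_simps)
  also have "\<dots> = (\<Sum>k\<in>keys \<mu>. if k = i then int (lookup \<mu> i) * (int (n - 1) * (int i - int c)) else 0)"
  proof (intro sum.cong refl)
    fix k assume "k \<in> keys \<mu>"
    hence k: "k \<in> covered" "1 \<le> k" "k \<le> n" using \<mu> by (auto simp: covered_def)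
    have eq: "(1 - int c) * int (n - k) + (int n - int c) * int (k - 1) = int (n - 1) * (int k - int c)"
      using k n by (simp add: of_nat_diff algebra_simps)
    have "k = i \<or> k = c" if "pt k = ?j"
      using covers_pt[OF k(1)] that c by (auto simp: covers_def doubleton_eq_iff)
    thus "int (lookup \<mu> k) * ((1 - int c) * int (lookup (?h k) (2 * ?j)) + (int n - int c) * int (lookup (?h k) (2 * ?j + 1)))
        = (if k = i then int (lookup \<mu> i) * (int (n - 1) * (int i - int c)) else 0)"
      unfolding h0 h1 using eq by auto
  qed
  also have "\<dots> = int (lookup \<mu> i) * (int (n - 1) * (int i - int c))"
    by (simp add: in_keys_iff)
  finally show ?thesis .
qed

lemma image_monomial_inj:
  assumes "keys \<mu> \<subseteq> covered" "keys \<nu> \<subseteq> covered"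
    and eq: "image_monomial (\<lambda>i. term_monomial (pt i) i) \<mu> = image_monomial (\<lambda>i. term_monomial (pt i) i) \<nu>"
  shows "\<mu> = \<nu>"
proof (rule poly_mapping_eqI)
  fix i
  show "lookup \<mu> i = lookup \<nu> i"
  proof (cases "i \<in> covered")
    case True
    obtain c where c: "{i, c} = {p (pt i), Suc (p (pt i))}" "i \<noteq> c"
      using covers_pt[OF True] unfolding covers_def by (metis insert_commute n_not_Suc_n)
    have "int (lookup \<mu> i) * (int (n - 1) * (int i - int c)) = int (lookup \<nu> i) * (int (n - 1) * (int i - int c))"
      unfolding lookup_image_covered[OF assms(1) True c(1), symmetric]
        lookup_image_covered[OF assms(2) True c(1), symmetric] eq ..
    thus ?thesis using c(2) n by simp
  next
    case False
    thus ?thesis using assms by (metis in_keys_iff subsetD)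
  qed
qed

lemma subst_secant_nonzero:
  fixes F :: "'k::field mpoly"
  assumes F: "F \<in> polyS n" and \<mu>: "\<mu> \<in> keys F" "keys \<mu> \<subseteq> covered"
    and max: "\<And>\<nu>. \<nu> \<in> keys F \<Longrightarrow> weight (sqw (n - 1)) \<nu> \<le> weight (sqw (n - 1)) \<mu>"
  shows "subst (secant n P R) F \<noteq> 0"
proof (rule subst_nonzero[where V = "{1..n}" and C = covered and W = "sqw (n - 1)"])
  show "top_form tw (sqw (n - 1) i) (if i \<in> covered then 1 else 0) (term_monomial (pt i) i) (secant n P R i :: 'k mpoly)"
    if "i \<in> {1..n}" for i
    using that by (intro top_form_secant) auto
  show "keys \<nu> \<subseteq> {1..n} \<and> weight (sqw (n - 1)) \<nu> \<le> weight (sqw (n - 1)) \<mu>" if "\<nu> \<in> keys F" for \<nu>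
    using that F max by (auto simp: polyS_def)
qed (use image_monomial_inj \<mu> in blast)+

end

section \<open>Joins with coordinate points: vanishing and nonvanishing determinants\<close>

lemma top_form_key:
  assumes "top_form w W 1 \<mu> (F :: 'k::field mpoly)"
  shows "\<mu> \<in> keys F" and "\<nu> \<in> keys F \<Longrightarrow> weight w \<nu> \<le> weight w \<mu>"
proof -
  obtain q where q: "F = single \<mu> 1 + q" "(1 :: 'k) \<noteq> 0 \<longrightarrow> weight w \<mu> = W" "\<forall>\<nu>\<in>keys q. weight w \<nu> < W"
    using assms by (rule top_formE)
  have "\<mu> \<notin> keys q" using q by auto
  thus "\<mu> \<in> keys F" unfolding q(1) by (simp add: in_keys_iff lookup_add)
  show "weight w \<nu> \<le> weight w \<mu>" if "\<nu> \<in> keys F"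
  proof -
    have "\<nu> = \<mu> \<or> \<nu> \<in> keys q"
      using that Poly_Mapping.keys_add[of "single \<mu> 1" q] unfolding q(1) by auto
    thus ?thesis using q by force
  qed
qed

text \<open>\<open>ker (subst (sec n k \<alpha> \<beta>))\<close> is the prime of the join of the \<open>k\<close>-th secant variety with the
  coordinate point for \<open>x\<^sub>1\<close> (if \<open>\<alpha>\<close>) and the one for \<open>x\<^sub>n\<close> (if \<open>\<beta>\<close>).\<close>

definition sec :: "nat \<Rightarrow> nat \<Rightarrow> bool \<Rightarrow> bool \<Rightarrow> nat \<Rightarrow> 'k::field mpoly" where
  "sec n k \<alpha> \<beta> = secant n ({2..<k + 2} \<union> (if \<alpha> then {0} else {})) ({2..<k + 2} \<union> (if \<beta> then {1} else {}))"

lemma sec_mono: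
  assumes "\<alpha>' \<longrightarrow> \<alpha>" "\<beta>' \<longrightarrow> \<beta>" "subst (sec n k \<alpha> \<beta>) F = 0"
  shows "subst (sec n k \<alpha>' \<beta>') F = 0"
  unfolding sec_def
  by (rule subst_secant_mono[OF permutes_id _ _ assms(3)[unfolded sec_def]])
     (use assms(1,2) in \<open>auto split: if_splits\<close>)

text \<open>The last of the \<open>k + 1\<close> points, labelled \<open>k + 2\<close>, is
  specialized to the coordinate point for x_1; the transposition gives it the label 0.\<close>

lemma sec_Suc_left:
  assumes "k < n" "subst (sec n (Suc k) \<alpha> \<beta>) F = 0"
  shows "subst (sec n k True \<beta>) F = 0"
  unfolding sec_def
proof (rule subst_secant_mono[OF permutes_swap_id _ _ assms(2)[unfolded sec_def]])
  show "0 \<in> {..<n + 2}" "k + 2 \<in> {..<n + 2}" using assms(1) by auto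
qed (auto simp: transpose_def split: if_splits)

lemma sec_Suc_right:
  assumes "k < n" "subst (sec n (Suc k) \<alpha> \<beta>) F = 0"
  shows "subst (sec n k \<alpha> True) F = 0"
  unfolding sec_def
proof (rule subst_secant_mono[OF permutes_swap_id _ _ assms(2)[unfolded sec_def]])
  show "1 \<in> {..<n + 2}" "k + 2 \<in> {..<n + 2}" using assms(1) by auto
qed (auto simp: transpose_def split: if_splits)

text \<open>Indices on the main diagonal of the determinant differ by at least 2, so each can be
  covered by a point of its own. The coordinate points cover the ends 1 and n when \<alpha> or
  \<beta> holds, and the k curve points cover the rest.\<close>

lemma sec_hankel_det_nonzero:
  assumes n: "n \<ge> 2" and k: "k \<le> n" and C: "finite C" "\<And>c. c \<in> C \<Longrightarrow> 1 \<le> c \<and> c + card C \<le> Suc n"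
    and card: "card C = k + of_bool \<alpha> + of_bool \<beta>"
    and \<alpha>: "\<alpha> \<Longrightarrow> 1 \<in> C" and \<beta>: "\<beta> \<Longrightarrow> Suc n - card C \<in> C"
  shows "subst (sec n k \<alpha> \<beta>) (hankel_det C) \<noteq> (0 :: 'k::field mpoly)"
proof -
  define cs where "cs = sorted_list_of_set C"
  define N where "N = card C"
  have cs: "length cs = N" "set cs = C" using C(1) by (simp_all add: cs_def N_def)
  have cs_less: "cs ! i < cs ! j" if "i < j" "j < N" for i j
    using sorted_wrt_nth_less[OF strict_sorted_list_of_set[of C]] that cs by (simp add: cs_def)
  define a where "a i = cs ! i + i" for i
  have a_less: "a i + 2 \<le> a j" if "i < j" "j < N" for i j
    using cs_less[OF that] that unfolding a_def by linarith
  have a_bd: "1 \<le> a i \<and> a i \<le> n" if "i < N" for i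
    using C(2)[of "cs ! i"] nth_mem[of i cs] that cs by (auto simp: a_def N_def)
  have a_first: "a 0 = 1" if \<alpha>
  proof -
    obtain l where l: "l < N" "cs ! l = 1"
      using \<alpha>[OF \<open>\<alpha>\<close>] cs by (metis in_set_conv_nth)
    have "l = 0" using cs_less[of 0 l] a_bd[of 0] l by (cases "l = 0") (auto simp: a_def)
    thus ?thesis using l by (simp add: a_def)
  qed
  have a_last: "a (N - 1) = n" if \<beta>
  proof -
    obtain l where l: "l < N" "cs ! l = Suc n - N"
      using \<beta>[OF \<open>\<beta>\<close>] cs unfolding N_def by (metis in_set_conv_nth)
    have "cs ! l \<le> cs ! (N - 1)" using cs_less[of l "N - 1"] l by (cases "l = N - 1") (simp, fastforce)
    moreover have "a (N - 1) \<le> n" using a_bd[of "N - 1"] l by simp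
    ultimately show ?thesis using l C(2)[of "cs ! l"] cs by (auto simp: a_def N_def)
  qed
  define s where "s = (of_bool \<alpha> :: nat)"
  have N: "N = k + s + of_bool \<beta>" using card by (simp add: N_def s_def)
  \<comment> \<open>Label 0 gets the pair 0, 1 and label 1 the pair n, n + 1, of which only the
    indices 1 and n matter. The offset \<open>s\<close> skips the first diagonal entry if label 0
    already covers it.\<close>
  define p where "p j = (if j = 0 then 0 else if j = 1 then n else a (j - 2 + s))" for j
  define P R where "P = {2..<k + 2} \<union> (if \<alpha> then {0} else {})" and "R = {2..<k + 2} \<union> (if \<beta> then {1::nat} else {})"
  have PR: "\<alpha> \<Longrightarrow> 0 \<in> P" "\<beta> \<Longrightarrow> 1 \<in> R" "\<And>j. 2 \<le> j \<Longrightarrow> j < k + 2 \<Longrightarrow> j \<in> P \<and> j \<in> R"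
    by (auto simp: P_def R_def)
  have sep: "p i + 1 < p j \<or> p j + 1 < p i" if ij: "i \<in> P \<union> R" "j \<in> P \<union> R" "i < j" for i j
  proof -
    have jr: "j - 2 + s < N" if "2 \<le> j" using that ij N by (auto simp: P_def R_def split: if_splits)
    consider "i = 0" "j = 1" | "i = 0" "2 \<le> j" | "i = 1" "2 \<le> j" | "2 \<le> i" "2 \<le> j" using \<open>i < j\<close> by linarith
    thus ?thesis
    proof cases
      case 1
      thus ?thesis using n by (simp add: p_def)
    next
      case 2
      hence \<alpha> using ij by (auto simp: P_def R_def split: if_splits)
      hence "a 0 + 2 \<le> a (j - 2 + s)" using jr 2 by (intro a_less) (auto simp: s_def)
      thus ?thesis using 2 by (simp add: p_def)
    next
      case 3
      hence \<beta> using ij by (auto simp: P_def R_def split: if_splits)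
      have "j - 2 + s < N - 1" using 3 ij N \<open>\<beta>\<close> by (auto simp: P_def R_def split: if_splits)
      hence "a (j - 2 + s) + 2 \<le> a (N - 1)" by (intro a_less) auto
      thus ?thesis using 3 a_last[OF \<open>\<beta>\<close>] by (simp add: p_def)
    next
      case 4
      hence "a (i - 2 + s) + 2 \<le> a (j - 2 + s)" using jr \<open>i < j\<close> by (intro a_less) auto
      thus ?thesis using 4 by (simp add: p_def)
    qed
  qed
  interpret tangent_weights n P R p
    by unfold_locales (use n in simp, metis sep linorder_neqE_nat)
  let ?\<mu> = "\<Sum>i<card C. single (a i) (1::nat)"
  have top: "top_form (sqw (n - 1)) (\<Sum>i<card C. sqw (n - 1) (a i)) 1 ?\<mu> (hankel_det C :: 'k mpoly)"
    using top_form_hankel_det[OF C(1), of "n - 1"] n by (simp add: a_def cs_def)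
  have "keys ?\<mu> \<subseteq> covered"
  proof
    fix x assume "x \<in> keys ?\<mu>"
    then obtain i where i: "i < N" "x = a i"
      using Poly_Mapping.keys_sum[of "\<lambda>i. single (a i) (1::nat)" "{..<card C}"] by (auto simp: N_def)
    have "\<exists>j. covers j x"
    proof (cases "\<alpha> \<and> i = 0 \<or> \<beta> \<and> i = N - 1")
      case True
      thus ?thesis
      proof
        assume "\<alpha> \<and> i = 0"
        thus ?thesis using i a_first PR(1) by (intro exI[of _ 0]) (auto simp: covers_def active_def p_def)
      next
        assume "\<beta> \<and> i = N - 1"
        thus ?thesis using i a_last n PR(2) by (intro exI[of _ 1]) (auto simp: covers_def active_def p_def)
      qed
    next
      case False
      hence "s \<le> i" "i - s < k" using i(1) N by (cases \<alpha>; cases \<beta>; auto simp: s_def)+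
      thus ?thesis using i k PR(3)[of "i - s + 2"] by (intro exI[of _ "i - s + 2"]) (auto simp: covers_def active_def p_def)
    qed
    thus "x \<in> covered" using a_bd[OF i(1)] i(2) by (auto simp: covered_def)
  qed
  hence "subst (secant n P R) (hankel_det C :: 'k mpoly) \<noteq> 0"
    using top_form_key[OF top] hankel_det_polyS[OF C] by (intro subst_secant_nonzero[of _ ?\<mu>]) auto
  thus ?thesis by (simp add: sec_def P_def R_def)
qed

text \<open>The bounds keep x_1 out if \<alpha> and x_n out if \<beta>, so the coordinate points
  contribute nothing. The substituted matrix is a sum over k points of products of a row factor and
  a column factor and has rank at most k.\<close>

lemma sec_det_zero:
  fixes e d :: "nat \<Rightarrow> nat"
  assumes n: "n \<ge> 2" and k: "k \<le> n"
    and e: "\<And>i. i \<le> k \<Longrightarrow> 1 + of_bool \<alpha> \<le> e i \<and> e i + D + of_bool \<beta> \<le> n"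
    and d: "\<And>j. j \<le> k \<Longrightarrow> d j \<le> D"
  shows "subst (sec n k \<alpha> \<beta>) (det (mat (Suc k) (Suc k) (\<lambda>(i, j). var (e i + d j)))) = (0 :: 'k::field mpoly)"
proof -
  interpret comm_ring_hom "subst (sec n k \<alpha> \<beta> :: nat \<Rightarrow> 'k mpoly)" by (rule comm_ring_hom_subst)
  let ?u = "\<lambda>l. var (2 * (l + 2)) :: 'k mpoly" and ?b = "\<lambda>l. var (2 * (l + 2) + 1) :: 'k mpoly"
  \<comment> \<open>The factorization through k points is padded by a zero column to make both
    factors square.\<close>
  define A where "A = mat (Suc k) (Suc k) (\<lambda>(i, l). if l < k then ?u l ^ (n - (e i + D)) * ?b l ^ (e i - 1) else 0)"
  define B where "B = mat (Suc k) (Suc k) (\<lambda>(l, j). ?u l ^ (D - d j) * ?b l ^ d j)"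
  have A: "A \<in> carrier_mat (Suc k) (Suc k)" and B: "B \<in> carrier_mat (Suc k) (Suc k)"
    by (simp_all add: A_def B_def)
  have entry: "sec n k \<alpha> \<beta> (e i + d j) = (\<Sum>l<k. (?u l ^ (n - (e i + D)) * ?b l ^ (e i - 1)) * (?u l ^ (D - d j) * ?b l ^ d j))"
    if ij: "i \<le> k" "j \<le> k" for i j
  proof -
    let ?x = "e i + d j"
    have bd: "1 + of_bool \<alpha> \<le> ?x" "?x + of_bool \<beta> \<le> n" using e[OF ij(1)] d[OF ij(2)] by auto
    let ?f = "\<lambda>l. (if l \<in> {2..<k + 2} \<union> (if \<alpha> then {0} else {}) then var (2 * l) else 0) ^ (n - ?x)
       * (if l \<in> {2..<k + 2} \<union> (if \<beta> then {1} else {}) then var (2 * l + 1) else 0) ^ (?x - 1) :: 'k mpoly"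
    have "sec n k \<alpha> \<beta> ?x = (\<Sum>l<n + 2. ?f l)" by (simp only: sec_def secant_def)
    also have "\<dots> = (\<Sum>l\<in>{0 + 2..<k + 2}. ?f l)"
    proof (rule sum.mono_neutral_right)
      have z: "(0 :: 'k mpoly) ^ (?x - 1) = 0" if \<alpha> using bd that by (simp add: zero_power)
      have z': "(0 :: 'k mpoly) ^ (n - ?x) = 0" if \<beta> using bd that by (simp add: zero_power)
      have "(0 :: 'k mpoly) ^ (n - ?x) = 0 \<or> (0 :: 'k mpoly) ^ (?x - 1) = 0" using bd n by (simp add: zero_power) linarith
      thus "\<forall>l\<in>{..<n + 2} - {0 + 2..<k + 2}. ?f l = 0" using z z' by auto
    qed (use k in auto)
    also have "\<dots> = (\<Sum>l<k. ?f (l + 2))"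
      unfolding sum.shift_bounds_nat_ivl by (simp add: atLeast0LessThan)
    also have "\<dots> = (\<Sum>l<k. (?u l ^ (n - (e i + D)) * ?b l ^ (e i - 1)) * (?u l ^ (D - d j) * ?b l ^ d j))"
    proof (intro sum.cong refl)
      fix l assume "l \<in> {..<k}"
      have "n - ?x = (n - (e i + D)) + (D - d j)" "?x - 1 = (e i - 1) + d j"
        using e[OF ij(1)] d[OF ij(2)] by auto
      moreover have "?f (l + 2) = ?u l ^ (n - ?x) * ?b l ^ (?x - 1)" using \<open>l \<in> {..<k}\<close> by simp
      ultimately show "?f (l + 2) = (?u l ^ (n - (e i + D)) * ?b l ^ (e i - 1)) * (?u l ^ (D - d j) * ?b l ^ d j)"
        by (simp only: power_add ac_simps)
    qed
    finally show ?thesis .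
  qed
  have "map_mat (subst (sec n k \<alpha> \<beta>)) (mat (Suc k) (Suc k) (\<lambda>(i, j). var (e i + d j))) = A * B"
    by (rule eq_matI) (auto simp: A_def B_def scalar_prod_def entry atLeast0LessThan intro!: sum.cong)
  hence "subst (sec n k \<alpha> \<beta>) (det (mat (Suc k) (Suc k) (\<lambda>(i, j). var (e i + d j)))) = det (A * B)"
    by (simp flip: hom_det)
  also have "\<dots> = det A * det B" by (rule det_mult[OF A B])
  also have "det A = 0"
    using laplace_expansion_column[OF A, of k] by (simp add: A_def)
  finally show ?thesis by simp
qed

section \<open>Reduction of vanishing polynomials modulo minors\<close>

lemma chain_cover:
  assumes "finite (A :: nat set)"
  shows "\<exists>a. sorted_wrt (\<lambda>x y. x + 2 \<le> y) a \<and> set a \<subseteq> A \<and> A \<subseteq> (\<Union>x\<in>set a. {x, Suc x})"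
  using assms
proof (induction A rule: finite_psubset_induct)
  case (psubset A)
  show ?case
  proof (cases "A = {}")
    case True
    thus ?thesis by (intro exI[of _ "[]"]) auto
  next
    case False
    define x where "x = Min A"
    have x: "x \<in> A" "\<And>y. y \<in> A \<Longrightarrow> x \<le> y" using psubset.hyps False by (auto simp: x_def)
    \<comment> \<open>Greedy choice: the minimum covers itself and its successor, and everything
      left is at least 2 larger.\<close>
    obtain a where a: "sorted_wrt (\<lambda>x y. x + 2 \<le> y) a" "set a \<subseteq> A - {x, Suc x}" "A - {x, Suc x} \<subseteq> (\<Union>x\<in>set a. {x, Suc x})"
      using psubset.IH[of "A - {x, Suc x}"] x by blast
    have "x + 2 \<le> y" if "y \<in> set a" for y
      using a(2) that x(2)[of y] by (cases "y = x"; cases "y = Suc x") auto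
    thus ?thesis using a x by (intro exI[of _ "x # a"]) auto
  qed
qed

lemma chain_gap:
  assumes "sorted_wrt (\<lambda>x y. x + 2 \<le> y) (a :: nat list)" "i \<le> j" "j < length a"
  shows "a ! i + 2 * (j - i) \<le> a ! j"
  using assms(2,3)
proof (induction j rule: dec_induct)
  case (step j)
  have "a ! j + 2 \<le> a ! Suc j"
    using sorted_wrt_nth_less[OF assms(1), of j "Suc j"] step.prems by simp
  thus ?case using step by simp
qed simp

text \<open>Reduction modulo the \<open>g\<close>: a leading monomial of a vanishing polynomial is divisible by the
  leading monomial of some \<open>g\<close>, since otherwise its support would be covered by \<open>k\<close> pairs.\<close>

lemma sec_vanishing_in_ideal:
  fixes I :: "'k::field mpoly set"
  assumes n: "n \<ge> 2" and k: "k \<le> n" and I: "is_idealS n I"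
    and chain: "\<And>a. sorted_wrt (\<lambda>x y. x + 2 \<le> y) a \<Longrightarrow> length a = Suc k \<Longrightarrow> set a \<subseteq> {1..n} \<Longrightarrow>
      \<exists>g\<in>I. subst (sec n k False False) g = 0
        \<and> top_form (sqw (n - 1)) (\<Sum>i<Suc k. sqw (n - 1) (a ! i)) 1 (\<Sum>i<Suc k. single (a ! i) 1) g"
    and F: "F \<in> polyS n" "subst (sec n k False False) F = 0"
  shows "F \<in> I"
proof -
  let ?w = "weight (sqw (n - 1))" and ?v = "sec n k False False :: nat \<Rightarrow> 'k mpoly"
  have w_nonneg: "0 \<le> ?w \<nu>" for \<nu> unfolding weight_def sqw_def by (intro sum_nonneg) simp
  have reducible: "\<exists>a. sorted_wrt (\<lambda>x y. x + 2 \<le> y) a \<and> length a = Suc k \<and> set a \<subseteq> keys \<mu>"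
    if F: "F \<in> polyS n" "subst ?v F = 0" and \<mu>: "\<mu> \<in> keys F" "\<And>\<nu>. \<nu> \<in> keys F \<Longrightarrow> ?w \<nu> \<le> ?w \<mu>"
    for F and \<mu>
  proof -
    obtain a where a: "sorted_wrt (\<lambda>x y. x + 2 \<le> y) a" "set a \<subseteq> keys \<mu>" "keys \<mu> \<subseteq> (\<Union>x\<in>set a. {x, Suc x})"
      using chain_cover[of "keys \<mu>"] by auto
    have bd: "keys \<mu> \<subseteq> {1..n}" using F(1) \<mu>(1) by (auto simp: polyS_def)
    show ?thesis
    proof (cases "length a \<le> k")
      case False
      thus ?thesis using a(1,2) set_take_subset[of "Suc k" a]
        by (intro exI[of _ "take (Suc k) a"]) (auto simp: sorted_wrt_take)
    next
      case True
      \<comment> \<open>Points left over get dummy pairs beyond n, spaced so that all pairs stay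
        disjoint.\<close>
      define p where "p j = (if j - 2 < length a then a ! (j - 2) else n + 2 * j + 2)" for j
      have sep: "p i + 1 < p j" if "2 \<le> i" "i < j" for i j
      proof (cases "j - 2 < length a")
        case True
        moreover have "i - 2 < j - 2" using that by linarith
        ultimately show ?thesis using sorted_wrt_nth_less[OF a(1), of "i - 2" "j - 2"] by (simp add: p_def)
      next
        case False
        have "p i \<le> n + 2 * i + 2"
          using nth_mem[of "i - 2" a] a(2) bd by (fastforce simp: p_def)
        thus ?thesis using False that by (simp add: p_def)
      qed
      define P where "P = {2..<k + 2}"
      interpret tangent_weights n P P p
      proof
        show "p i + 1 < p j \<or> p j + 1 < p i"
          if "i \<in> P \<union> P" "j \<in> P \<union> P" "i \<noteq> j" for i j
          using sep[of i j] sep[of j i] that unfolding P_def by (cases i j rule: linorder_cases) auto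
      qed (use n in simp)
      have "keys \<mu> \<subseteq> covered"
      proof
        fix x assume x: "x \<in> keys \<mu>"
        then obtain l where l: "l < length a" "x = a ! l \<or> x = Suc (a ! l)"
          using a(3) by (fastforce simp: in_set_conv_nth)
        moreover have "l + 2 \<in> P" using l True by (simp add: P_def)
        ultimately have "covers (l + 2) x" using True k by (auto simp: covers_def active_def p_def)
        thus "x \<in> covered" using x bd by (auto simp: covered_def)
      qed
      hence "subst (secant n P P) F \<noteq> 0"
        using F(1) \<mu> by (intro subst_secant_nonzero[of _ \<mu>]) auto
      thus ?thesis using F(2) by (simp add: sec_def P_def)
    qed
  qed
  \<comment> \<open>Outer induction on a weight bound, inner induction on the number of monomials of
    maximal admissible weight; each reduction removes one of them and adds only lighter
    ones.\<close>
  have main: "F \<in> I" if "F \<in> polyS n" "subst ?v F = 0" "\<And>\<nu>. \<nu> \<in> keys F \<Longrightarrow> ?w \<nu> < int W" for W F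
    using that
  proof (induction W arbitrary: F)
    case 0
    have "\<nu> \<notin> keys F" for \<nu> using 0(3)[of \<nu>] w_nonneg[of \<nu>] by auto
    hence "keys F = {}" by blast
    thus ?case using is_idealS_zero[OF I] by simp
  next
    case (Suc W)
    define T where "T F = {\<nu> \<in> keys F. ?w \<nu> = int W}" for F :: "'k mpoly"
    have "F \<in> I" if "card (T F) = c" "F \<in> polyS n" "subst ?v F = 0" "\<And>\<nu>. \<nu> \<in> keys F \<Longrightarrow> ?w \<nu> < int (Suc W)" for c F
      using that
    proof (induction c arbitrary: F)
      case 0
      have "T F = {}" using 0(1) by (simp add: T_def)
      hence "?w \<nu> < int W" if "\<nu> \<in> keys F" for \<nu> using 0(4)[OF that] that by (force simp: T_def)
      thus ?case using Suc.IH 0 by blast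
    next
      case (Suc c)
      then obtain \<mu> where "\<mu> \<in> T F" by (metis card.empty ex_in_conv nat.distinct(1))
      hence \<mu>: "\<mu> \<in> keys F" "?w \<mu> = int W" by (auto simp: T_def)
      have "?w \<nu> \<le> ?w \<mu>" if "\<nu> \<in> keys F" for \<nu> using Suc.prems(4)[OF that] \<mu>(2) by simp
      then obtain a where a: "sorted_wrt (\<lambda>x y. x + 2 \<le> y) a" "length a = Suc k" "set a \<subseteq> keys \<mu>"
        using reducible[OF Suc.prems(2,3) \<mu>(1)] by blast
      have bd: "keys \<mu> \<subseteq> {1..n}" using Suc.prems(2) \<mu>(1) by (auto simp: polyS_def)
      let ?h = "\<Sum>i<Suc k. single (a ! i) (1::nat)"
      obtain g where g: "g \<in> I" "subst ?v g = 0"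
        "top_form (sqw (n - 1)) (\<Sum>i<Suc k. sqw (n - 1) (a ! i)) 1 ?h g"
        using chain[OF a(1,2)] a(3) bd by auto
      have "distinct a" using sorted_wrt_nth_less[OF a(1)] by (fastforce simp: distinct_conv_nth nat_neq_iff)
      have h_le: "lookup ?h x \<le> lookup \<mu> x" for x
      proof -
        have "lookup ?h x = card {i \<in> {..<Suc k}. a ! i = x}"
          by (simp add: lookup_sum lookup_single when_def sum.If_cases Int_def del: sum.lessThan_Suc)
        also have "\<dots> \<le> lookup \<mu> x"
        proof (cases "x \<in> set a")
          case True
          then obtain i where i: "i < Suc k" "a ! i = x" using a(2) by (auto simp: in_set_conv_nth)
          hence "{i \<in> {..<Suc k}. a ! i = x} = {i}" using nth_eq_iff_index_eq[OF \<open>distinct a\<close>] a(2) by auto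
          moreover have "lookup \<mu> x \<noteq> 0" using True a(3) by (auto simp: in_keys_iff)
          ultimately show ?thesis by simp
        next
          case False
          hence "{i \<in> {..<Suc k}. a ! i = x} = {}" using a(2) by auto
          thus ?thesis by (simp only: card.empty le0)
        qed
        finally show ?thesis .
      qed
      \<comment> \<open>Subtraction of exponents truncates at 0; \<open>h_le\<close> ensures that it
        is an exact division of monomials.\<close>
      define \<rho> where "\<rho> = \<mu> - ?h"
      have \<mu>_eq: "\<rho> + ?h = \<mu>"
        by (rule poly_mapping_eqI) (use h_le in \<open>simp add: \<rho>_def lookup_add lookup_minus\<close>)
      have "keys \<rho> \<subseteq> keys \<mu>"
        by (auto simp: \<rho>_def in_keys_iff lookup_minus simp del: sum.lessThan_Suc)
      hence "keys \<rho> \<subseteq> {1..n}" using bd by blast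
      hence S\<rho>: "single \<rho> (lookup F \<mu>) \<in> polyS n" by (rule single_polyS)
      let ?G = "single \<rho> (lookup F \<mu>) * g"
      have "top_form (sqw (n - 1)) (?w \<rho>) (lookup F \<mu>) \<rho> (single \<rho> (lookup F \<mu>))"
        by (rule top_formI[of _ _ _ 0]) simp_all
      from top_form_mult[OF this g(3)]
      have "top_form (sqw (n - 1)) (?w \<rho> + (\<Sum>i<Suc k. sqw (n - 1) (a ! i))) (lookup F \<mu>) \<mu> ?G"
        unfolding \<mu>_eq by (simp only: mult_1_right)
      then obtain q where q: "?G = single \<mu> (lookup F \<mu>) + q"
        "lookup F \<mu> \<noteq> 0 \<longrightarrow> ?w \<mu> = ?w \<rho> + (\<Sum>i<Suc k. sqw (n - 1) (a ! i))"
        "\<forall>\<nu>\<in>keys q. ?w \<nu> < ?w \<rho> + (\<Sum>i<Suc k. sqw (n - 1) (a ! i))"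
        by (rule top_formE)
      have low: "?w \<nu> < int W" if "\<nu> \<in> keys q" for \<nu>
      proof -
        have "lookup F \<mu> \<noteq> 0" using \<mu>(1) by (simp add: in_keys_iff)
        thus ?thesis using q(2) bspec[OF q(3) that] \<mu>(2) by linarith
      qed
      have GI: "?G \<in> I" by (rule is_idealS_mult[OF I g(1) S\<rho>])
      define F' where "F' = F - ?G"
      have look: "lookup F' \<nu> = (if \<nu> = \<mu> then 0 else lookup F \<nu>) - lookup q \<nu>" for \<nu>
        unfolding F'_def q(1) by (simp add: lookup_minus lookup_add lookup_single when_def)
      have "F' \<in> I"
      proof (rule Suc.IH)
        have "T F' = T F - {\<mu>}"
        proof -
          have q0: "lookup q \<nu> = 0" if "?w \<nu> = int W" for \<nu>
            using low[of \<nu>] that by (cases "lookup q \<nu> = 0") (simp_all add: in_keys_iff)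
          have "\<nu> \<in> keys F' \<longleftrightarrow> \<nu> \<in> keys F - {\<mu>}" if "?w \<nu> = int W" for \<nu>
            using q0[OF that] look[of \<nu>] by (simp add: in_keys_iff)
          thus ?thesis unfolding T_def by blast
        qed
        thus "card (T F') = c" using Suc.prems(1) \<open>\<mu> \<in> T F\<close> by (simp add: T_def)
        show "F' \<in> polyS n"
          using add_polyS[OF Suc.prems(2) uminus_polyS] GI is_idealS_sub[OF I] by (auto simp: F'_def)
        show "subst ?v F' = 0"
          using subst_add[of ?v F "- ?G"] Suc.prems(3) g(2) by (simp add: F'_def)
        show "?w \<nu> < int (Suc W)" if "\<nu> \<in> keys F'" for \<nu>
        proof -
          have "\<nu> \<in> keys F \<or> \<nu> \<in> keys q" using that look[of \<nu>] by (cases "\<nu> = \<mu>") (auto simp: in_keys_iff)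
          thus ?thesis using Suc.prems(4)[of \<nu>] low[of \<nu>] by auto
        qed
      qed
      from is_idealS_add[OF I this GI] show ?case by (simp add: F'_def)
    qed
    thus ?case using Suc.prems by blast
  qed
  have "?w \<nu> < int (Suc (nat (\<Sum>\<nu>\<in>keys F. ?w \<nu>)))" if "\<nu> \<in> keys F" for \<nu>
  proof -
    have "?w \<nu> \<le> (\<Sum>\<nu>\<in>keys F. ?w \<nu>)" using w_nonneg that by (intro member_le_sum) auto
    thus ?thesis by linarith
  qed
  thus ?thesis by (rule main[OF F])
qed

subsection \<open>Leading monomials are attained by minors\<close>

text \<open>Subtracting i from the i-th diagonal index recovers the row label. Gaps of at least 2
  keep the labels strictly increasing and bounded by n - k.\<close>

lemma chain_hankel_det:
  assumes a: "sorted_wrt (\<lambda>x y. x + 2 \<le> y) a" "length a = Suc k" "set a \<subseteq> {1..n}" and n: "n \<ge> 2"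
  obtains C where "C \<subseteq> {1..n - k}" "card C = Suc k"
    "top_form (sqw (n - 1)) (\<Sum>i<Suc k. sqw (n - 1) (a ! i)) 1 (\<Sum>i<Suc k. single (a ! i) 1) (hankel_det C :: 'k::field mpoly)"
proof -
  define f where "f i = a ! i - i" for i
  have bd: "1 \<le> a ! i \<and> a ! i \<le> n" if "i < Suc k" for i
    using subsetD[OF a(3) nth_mem[of i a]] that a(2) by simp
  have low: "1 + 2 * i \<le> a ! i" if "i < Suc k" for i
    using chain_gap[OF a(1), of 0 i] bd[of 0] that a(2) by auto
  have high: "a ! i + 2 * (k - i) \<le> n" if "i < Suc k" for i
    using chain_gap[OF a(1), of i k] bd[of k] that a(2) by auto
  have f_less: "f i < f j" if "i < j" "j < Suc k" for i j
    using chain_gap[OF a(1), of i j] that a(2) low[of i] by (auto simp: f_def)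
  let ?xs = "map f [0..<Suc k]"
  have xs: "sorted_wrt (<) ?xs"
    by (auto simp: sorted_wrt_iff_nth_less nth_append f_less simp del: upt_Suc)
  define C where "C = set ?xs"
  have sl: "sorted_list_of_set C = ?xs"
    unfolding C_def using xs by (intro sorted_list_of_set.idem_if_sorted_distinct) (auto simp: strict_sorted_iff)
  have card: "card C = Suc k"
    using xs distinct_card[of ?xs] unfolding C_def strict_sorted_iff by (simp only: length_map length_upt diff_zero)
  show ?thesis
  proof
    show "C \<subseteq> {1..n - k}"
    proof
      fix c assume "c \<in> C"
      moreover have "C = f ` {..<Suc k}" by (simp add: C_def atLeast0LessThan del: upt_Suc)
      ultimately obtain i where "i < Suc k" "c = f i" by blast
      thus "c \<in> {1..n - k}" using low[of i] high[of i] by (auto simp: f_def)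
    qed
    have nth: "sorted_list_of_set C ! i + i = a ! i" if "i < Suc k" for i
      using that low[OF that] by (simp add: sl f_def del: upt_Suc)
    have "(\<Sum>i<Suc k. sqw (n - 1) (sorted_list_of_set C ! i + i)) = (\<Sum>i<Suc k. sqw (n - 1) (a ! i))"
      "(\<Sum>i<Suc k. single (sorted_list_of_set C ! i + i) (1::nat)) = (\<Sum>i<Suc k. single (a ! i) 1)"
      by (intro sum.cong refl; simp only: nth lessThan_iff)+
    thus "top_form (sqw (n - 1)) (\<Sum>i<Suc k. sqw (n - 1) (a ! i)) 1 (\<Sum>i<Suc k. single (a ! i) 1) (hankel_det C :: 'k mpoly)"
      using top_form_hankel_det[of C "n - 1"] n card unfolding card by (simp add: C_def del: sum.lessThan_Suc)
  qed (rule card)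
qed

lemma inj_on_increasing:
  fixes f :: "nat \<Rightarrow> nat"
  assumes "\<And>i j. i < j \<Longrightarrow> j < t \<Longrightarrow> f i < f j"
  shows "inj_on f {..<t}"
proof (rule inj_onI)
  fix x y assume "x \<in> {..<t}" "y \<in> {..<t}" "f x = f y"
  thus "x = y" using assms[of x y] assms[of y x] by (cases x y rule: linorder_cases) auto
qed

lemma pick_image_mono:
  assumes f: "\<And>i j. i < j \<Longrightarrow> j < t \<Longrightarrow> f i < f j" and i: "i < t"
  shows "pick (f ` {..<t}) i = (f i :: nat)"
proof -
  have inj: "inj_on f {..<i}"
    by (rule inj_on_subset[OF inj_on_increasing[OF f]]) (use i in auto)
  have "{x \<in> f ` {..<t}. x < f i} = f ` {..<i}"
  proof (intro equalityI subsetI)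
    fix x assume "x \<in> {x \<in> f ` {..<t}. x < f i}"
    then obtain j where j: "j < t" "x = f j" "f j < f i" by blast
    hence "j < i" using f[of i j] by (cases j i rule: linorder_cases) auto
    thus "x \<in> f ` {..<i}" using j by blast
  next
    fix x assume "x \<in> f ` {..<i}"
    then obtain j where "j < i" "x = f j" by blast
    thus "x \<in> {x \<in> f ` {..<t}. x < f i}" using f[of j i] i by auto
  qed
  hence "card {x \<in> f ` {..<t}. x < f i} = i"
    using card_image[OF inj] by simp
  thus ?thesis using pick_card_in_set[of "f i" "f ` {..<t}"] i by simp
qed

lemma hankel_minor:
  assumes "R \<subseteq> {..<m}" "C \<subseteq> {..<Suc m}" "card R = t" "card C = t"
  shows "det (submatrix (hankel m 1 (2 * m)) R C) = (det (mat t t (\<lambda>(i, j). var (Suc (pick R i) + pick C j))) :: 'k::field mpoly)"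
    and "i < t \<Longrightarrow> pick R i < m" and "i < t \<Longrightarrow> pick C i \<le> m"
proof -
  show R: "pick R i < m" if "i < t" for i
    using pick_in_set_le[of i R] that assms by auto
  show C: "pick C i \<le> m" if "i < t" for i
    using pick_in_set_le[of i C] that assms by fastforce
  have "{i. i < m \<and> i \<in> R} = R" "{j. j < Suc m \<and> j \<in> C} = C" using assms by auto
  thus "det (submatrix (hankel m 1 (2 * m)) R C) = (det (mat t t (\<lambda>(i, j). var (Suc (pick R i) + pick C j))) :: 'k mpoly)"
    using assms(3,4) R C
    by (intro arg_cong[where f = det] eq_matI) (auto simp: submatrix_def hankel_def less_Suc_eq_le)
qed

text \<open>Each diagonal index is split evenly as 1 + row + column. Halving keeps rows below m and
  columns at most m, and gaps of at least 2 make both sequences strictly increasing.\<close>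

lemma chain_minor:
  assumes a: "sorted_wrt (\<lambda>x y. x + 2 \<le> y) a" "length a = Suc k" "set a \<subseteq> {1..2 * m}" and m: "m \<ge> 1"
  obtains g where "g \<in> minors (Suc k) (hankel m 1 (2 * m) :: 'k::field mpoly mat)"
    "top_form (sqw (2 * m - 1)) (\<Sum>i<Suc k. sqw (2 * m - 1) (a ! i)) 1 (\<Sum>i<Suc k. single (a ! i) 1) g"
proof -
  define r where "r i = (a ! i - 1) div 2" for i
  define c where "c i = a ! i div 2" for i
  have bd: "1 \<le> a ! i \<and> a ! i \<le> 2 * m" if "i < Suc k" for i
    using subsetD[OF a(3) nth_mem[of i a]] that a(2) by simp
  have sum: "Suc (r i) + c i = a ! i" if "i < Suc k" for i
    using bd[OF that] unfolding r_def c_def by presburger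
  have gap: "a ! i + 2 \<le> a ! j" if "i < j" "j < Suc k" for i j
    using sorted_wrt_nth_less[OF a(1), of i j] that a(2) by simp
  have r: "r i < r j" and c: "c i < c j" if "i < j" "j < Suc k" for i j
    using gap[OF that] bd[of i] that unfolding r_def c_def by linarith+
  let ?R = "r ` {..<Suc k}" and ?C = "c ` {..<Suc k}"
  have sub: "?R \<subseteq> {..<m}" "?C \<subseteq> {..<Suc m}"
    using bd m unfolding r_def c_def by fastforce+
  have "inj_on r {..<Suc k}" "inj_on c {..<Suc k}"
    using r c by (auto intro: inj_on_increasing)
  hence card: "card ?R = Suc k" "card ?C = Suc k" by (simp_all only: card_image card_lessThan)
  let ?g = "det (submatrix (hankel m 1 (2 * m)) ?R ?C) :: 'k mpoly"
  have "?g = det (mat (Suc k) (Suc k) (\<lambda>(i, j). var (Suc (pick ?R i) + pick ?C j)))"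
    by (rule hankel_minor(1)[OF sub card])
  also have "mat (Suc k) (Suc k) (\<lambda>(i, j). var (Suc (pick ?R i) + pick ?C j)) = mat (Suc k) (Suc k) (\<lambda>(i, j). var (Suc (r i) + c j) :: 'k mpoly)"
    by (rule eq_matI) (simp_all only: index_mat dim_row_mat dim_col_mat split pick_image_mono[of "Suc k" r, OF r] pick_image_mono[of "Suc k" c, OF c])
  finally have g: "?g = det (mat (Suc k) (Suc k) (\<lambda>(i, j). var (Suc (r i) + c j)))" .
  show ?thesis
  proof
    show "?g \<in> minors (Suc k) (hankel m 1 (2 * m))"
      unfolding minors_def
      by (rule CollectI, rule exI[of _ ?R], rule exI[of _ ?C]) (use sub card in \<open>simp add: hankel_def\<close>)
    have "top_form (sqw (2 * m - 1)) (\<Sum>i<Suc k. sqw (2 * m - 1) (Suc (r i) + c i)) 1 (\<Sum>i<Suc k. single (Suc (r i) + c i) 1) ?g"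
      unfolding g by (rule top_form_det) (use m r c in auto)
    moreover have "(\<Sum>i<Suc k. sqw (2 * m - 1) (Suc (r i) + c i)) = (\<Sum>i<Suc k. sqw (2 * m - 1) (a ! i))"
      "(\<Sum>i<Suc k. single (Suc (r i) + c i) (1::nat)) = (\<Sum>i<Suc k. single (a ! i) 1)"
      by (intro sum.cong refl; simp only: sum lessThan_iff)+
    ultimately show "top_form (sqw (2 * m - 1)) (\<Sum>i<Suc k. sqw (2 * m - 1) (a ! i)) 1 (\<Sum>i<Suc k. single (a ! i) 1) ?g"
      by (simp only:)
  qed
qed

text \<open>Both ideals vanish on the k-th secant variety, and each contains minors with all the
  leading monomials that reduction requires. By \<open>sec_vanishing_in_ideal\<close> each therefore
  contains the other.\<close>

lemma minor_ideal_unique: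
  fixes I :: "'k::field mpoly set"
  assumes m: "m \<ge> 1" and k: "k < m" and I: "is_idealS (2 * m) I"
    and vanish: "\<And>p. p \<in> I \<Longrightarrow> subst (sec (2 * m) k False False) p = 0"
    and dets: "\<And>C. C \<subseteq> {1..2 * m - k} \<Longrightarrow> card C = Suc k \<Longrightarrow> hankel_det C \<in> I"
  shows "minor_idealS (2 * m) (Suc k) (hankel m 1 (2 * m)) = I"
proof -
  let ?n = "2 * m" and ?M = "minors (Suc k) (hankel m 1 (2 * m)) :: 'k mpoly set"
  let ?v = "sec ?n k False False :: nat \<Rightarrow> 'k mpoly"
  let ?J = "minor_idealS ?n (Suc k) (hankel m 1 (2 * m)) :: 'k mpoly set"
  have n: "?n \<ge> 2" "k \<le> ?n" using m k by auto
  have minor: "g \<in> polyS ?n \<and> subst ?v g = 0" if "g \<in> ?M" for g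
  proof -
    obtain R C where RC: "R \<subseteq> {..<m}" "C \<subseteq> {..<Suc m}" "card R = Suc k" "card C = Suc k"
      "g = det (submatrix (hankel m 1 (2 * m)) R C)"
      using \<open>g \<in> ?M\<close> unfolding minors_def by (auto simp: hankel_def)
    note pm = hankel_minor(2,3)[OF RC(1-4)]
    have g: "g = det (mat (Suc k) (Suc k) (\<lambda>(i, j). var (Suc (pick R i) + pick C j)))"
      unfolding RC(5) by (rule hankel_minor(1)[OF RC(1-4)])
    have "g \<in> polyS ?n"
      unfolding g using pm by (intro det_polyS[of _ "Suc k"]) (force intro!: var_polyS)+
    moreover have "subst ?v g = 0"
      unfolding g
    proof (rule sec_det_zero[OF n, where D = m])
      show "1 + of_bool False \<le> Suc (pick R i) \<and> Suc (pick R i) + m + of_bool False \<le> ?n" if "i \<le> k" for i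
        using pm(1)[of i] that by simp
      show "pick C j \<le> m" if "j \<le> k" for j using pm(2)[of j] that by simp
    qed
    ultimately show ?thesis ..
  qed
  have J: "is_idealS ?n ?J"
    unfolding minor_idealS_def using minor by (intro is_idealS_ideal_genS) auto
  have "is_idealS ?n {p \<in> polyS ?n. subst ?v p = 0}"
    unfolding is_idealS_def by (auto intro: add_polyS mult_polyS)
  hence J_van: "?J \<subseteq> {p \<in> polyS ?n. subst ?v p = 0}"
    unfolding minor_idealS_def by (rule ideal_genS_least) (use minor in auto)
  show ?thesis
  proof (intro equalityI subsetI)
    fix p assume "p \<in> ?J"
    hence p: "p \<in> polyS ?n" "subst ?v p = 0" using J_van by auto
    show "p \<in> I"
    proof (rule sec_vanishing_in_ideal[OF n I _ p])
      fix a assume "sorted_wrt (\<lambda>x y. x + 2 \<le> y) a" "length a = Suc k" "set a \<subseteq> {1..?n}"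
      then obtain C where "C \<subseteq> {1..?n - k}" "card C = Suc k"
        "top_form (sqw (?n - 1)) (\<Sum>i<Suc k. sqw (?n - 1) (a ! i)) 1 (\<Sum>i<Suc k. single (a ! i) 1) (hankel_det C :: 'k mpoly)"
        using n(1) by (rule chain_hankel_det)
      thus "\<exists>g\<in>I. subst ?v g = 0 \<and> top_form (sqw (?n - 1)) (\<Sum>i<Suc k. sqw (?n - 1) (a ! i)) 1 (\<Sum>i<Suc k. single (a ! i) 1) g"
        using dets vanish by blast
    qed
  next
    fix p assume "p \<in> I"
    hence p: "p \<in> polyS ?n" "subst ?v p = 0" using vanish is_idealS_sub[OF I] by auto
    show "p \<in> ?J"
    proof (rule sec_vanishing_in_ideal[OF n J _ p])
      fix a assume "sorted_wrt (\<lambda>x y. x + 2 \<le> y) a" "length a = Suc k" "set a \<subseteq> {1..?n}"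
      then obtain g where g: "g \<in> ?M"
        "top_form (sqw (?n - 1)) (\<Sum>i<Suc k. sqw (?n - 1) (a ! i)) 1 (\<Sum>i<Suc k. single (a ! i) 1) g"
        using m by (rule chain_minor)
      moreover have "g \<in> ?J" unfolding minor_idealS_def using g(1) ideal_genS_superset by blast
      ultimately show "\<exists>g\<in>?J. subst ?v g = 0 \<and> top_form (sqw (?n - 1)) (\<Sum>i<Suc k. sqw (?n - 1) (a ! i)) 1 (\<Sum>i<Suc k. single (a ! i) 1) g"
        using minor by blast
    qed
  qed
qed

subsection \<open>The descending construction\<close>

definition contains_dets :: "'k::field mpoly set \<Rightarrow> nat \<Rightarrow> nat \<Rightarrow> nat \<Rightarrow> bool" where
  "contains_dets I t l u \<longleftrightarrow> (\<forall>C \<subseteq> {l..u}. card C = t \<longrightarrow> hankel_det C \<in> I)"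

lemma contains_detsD: "contains_dets I t l u \<Longrightarrow> C \<subseteq> {l..u} \<Longrightarrow> card C = t \<Longrightarrow> hankel_det C \<in> I"
  by (simp add: contains_dets_def)

lemma contains_dets_mono: "contains_dets I t l u \<Longrightarrow> I \<subseteq> J \<Longrightarrow> contains_dets J t l u"
  by (auto simp: contains_dets_def)

lemma hankel_det_interval_polyS:
  assumes "C \<subseteq> {l..u}" "1 \<le> l" "u + card C \<le> Suc n"
  shows "hankel_det C \<in> polyS n"
  using assms finite_subset[OF assms(1)] by (intro hankel_det_polyS) force+

lemma secant_hankel_det_nonzero:
  assumes "n \<ge> 2" "k \<le> n" "D \<subseteq> {l..u}" "card D = k" "1 \<le> l" "u + k \<le> Suc n"
  shows "subst (sec n k False False) (hankel_det D) \<noteq> (0 :: 'k::field mpoly)"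
proof (rule sec_hankel_det_nonzero[OF assms(1,2)])
  show "finite D" using assms(3) by (rule finite_subset) simp
  show "1 \<le> c \<and> c + card D \<le> Suc n" if "c \<in> D" for c
    using subsetD[OF assms(3) that] assms(4-6) by simp
qed (use assms(4) in simp_all)

lemma extend_dets:
  assumes f: "f \<in> polyS n" and A: "A \<in> classC n f" "\<And>p. p \<in> A \<Longrightarrow> subst v p = 0"
    and bd: "1 \<le> l" "u + t \<le> Suc n"
    and ex: "\<And>C. C \<subseteq> {l..u} \<Longrightarrow> card C = t \<Longrightarrow> hankel_det C \<notin> A \<Longrightarrow>
      \<exists>g\<in>polyS n. subst v g \<noteq> 0 \<and> hankel_det C * g \<in> A"
  obtains B where "B \<in> classC n f" "A \<subseteq> B" "\<And>p. p \<in> B \<Longrightarrow> subst v p = (0 :: 'k::field mpoly)" "contains_dets B t l u"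
proof -
  let ?N = "hankel_det ` {C. C \<subseteq> {l..u} \<and> card C = t} :: 'k mpoly set"
  have "\<exists>B\<in>classC n f. A \<subseteq> B \<and> ?N \<subseteq> B \<and> (\<forall>p\<in>B. subst v p = 0)"
  proof (rule classC_extend[OF f A])
    show "finite ?N" by (rule finite_imageI, rule finite_subset[of _ "Pow {l..u}"]) auto
    fix x assume "x \<in> ?N"
    then obtain C where C: "C \<subseteq> {l..u}" "card C = t" "x = hankel_det C" by blast
    have "\<exists>g\<in>polyS n. subst v g \<noteq> 0 \<and> x * g \<in> A"
    proof (cases "x \<in> A")
      case True
      thus ?thesis by (intro bexI[of _ 1]) auto
    next
      case False
      thus ?thesis using ex[OF C(1,2)] C(3) by simp
    qed
    moreover have "x \<in> polyS n"
      unfolding C(3) by (rule hankel_det_interval_polyS[OF C(1)]) (use bd C(2) in auto)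
    ultimately show "x \<in> polyS n \<and> (\<exists>g\<in>polyS n. subst v g \<noteq> 0 \<and> x * g \<in> A)" by blast
  qed
  then obtain B where B: "B \<in> classC n f" "A \<subseteq> B" "?N \<subseteq> B" "\<forall>p\<in>B. subst v p = 0" by blast
  have "contains_dets B t l u" unfolding contains_dets_def using B(3) by blast
  thus ?thesis using B by (intro that[of B]) auto
qed

lemma ex_fresh:
  assumes "finite E" "card E < card A"
  shows "\<exists>e\<in>A. e \<notin> E"
  using assms card_mono[of E A] by (meson not_le subsetI)

text \<open>A determinant not yet in \<open>A\<close> uses both end rows \<open>l\<close> and
  \<open>u\<close>. Exchanging either of them for a fresh inner row \<open>e\<close> gives elements
  of \<open>A\<close>, and the resulting multiplier has t - 1 rows strictly inside the
  interval.\<close>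

lemma extend_interval:
  assumes f: "f \<in> polyS n" and A: "A \<in> classC n f" "\<And>p. p \<in> A \<Longrightarrow> subst v p = 0"
    and bd: "1 \<le> l" "l + t \<le> u" "u + t \<le> Suc n"
    and low: "contains_dets A t l (u - 1)" and high: "contains_dets A t (Suc l) u"
    and nz: "\<And>D. D \<subseteq> {Suc l..u - 1} \<Longrightarrow> Suc (card D) = t \<Longrightarrow> subst v (hankel_det D) \<noteq> 0"
  obtains B where "B \<in> classC n f" "A \<subseteq> B" "\<And>p. p \<in> B \<Longrightarrow> subst v p = (0 :: 'k::field mpoly)" "contains_dets B t l u"
proof (rule extend_dets[OF f A bd(1,3) _ that])
  fix C assume C: "C \<subseteq> {l..u}" "card C = t" "hankel_det C \<notin> A"
  have I: "is_idealS n A" by (rule is_idealS_classC[OF f A(1)])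
  have fin: "finite C" using C(1) by (rule finite_subset) simp
  have "l \<in> C"
  proof (rule ccontr)
    assume "l \<notin> C"
    hence "C \<subseteq> {Suc l..u}" using C(1) by (force simp: Suc_le_eq order_less_le)
    thus False using contains_detsD[OF high _ C(2)] C(3) by blast
  qed
  have "u \<in> C"
  proof (rule ccontr)
    assume "u \<notin> C"
    hence "c \<le> u - 1" if "c \<in> C" for c using C(1) that by (cases "c = u") force+
    hence "C \<subseteq> {l..u - 1}" using C(1) by auto
    thus False using contains_detsD[OF low _ C(2)] C(3) by blast
  qed
  define E where "E = C - {l, u}"
  have t: "t \<ge> 1" using C(2) \<open>l \<in> C\<close> fin by (auto simp: Suc_le_eq card_gt_0_iff)
  hence lu: "l < u" using bd by simp
  have CE: "C = insert l (insert u E)" "l \<notin> E" "u \<notin> E" "finite E"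
    using \<open>l \<in> C\<close> \<open>u \<in> C\<close> fin by (auto simp: E_def)
  have cE: "card E + 2 = t" using C(2) CE lu by simp
  have ES: "E \<subseteq> {Suc l..u - 1}"
  proof
    fix x assume "x \<in> E"
    hence "l \<le> x" "x \<le> u" "x \<noteq> l" "x \<noteq> u" using C(1) by (auto simp: E_def)
    thus "x \<in> {Suc l..u - 1}" by auto
  qed
  \<comment> \<open>There are u - l - 1 inner rows and only t - 2 of them lie in \<open>E\<close>;
    \<open>l + t \<le> u\<close> leaves one free.\<close>
  obtain e where e: "e \<in> {Suc l..u - 1}" "e \<notin> E"
  proof -
    have "card E < card {Suc l..u - 1}" using cE bd(2) by simp
    thus ?thesis using ex_fresh[OF CE(4)] that by blast
  qed
  have cards: "card (insert e E) = card E + 1" "card (insert l (insert e E)) = t" "card (insert u (insert e E)) = t"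
    using e CE cE lu by (auto simp: card_insert_if)
  have pe: "hankel_det (insert l (insert e E)) \<in> A"
    by (rule contains_detsD[OF low _ cards(2)]) (use e ES in auto)
  have qe: "hankel_det (insert u (insert e E)) \<in> A"
    by (rule contains_detsD[OF high _ cards(3)])
       (use e lu subset_trans[OF ES, of "{Suc l..u}"] in auto)
  have "hankel_det (insert l (insert u E)) * hankel_det (insert e E) \<in> A"
  proof (rule hankel_det_exchange(2)[OF I CE(4) CE(2,3) e(2) _ _ _ _ pe qe])
    show "1 \<le> c \<and> c + card E + 1 \<le> n" if "c \<in> {l, u, e} \<union> E" for c
      using that C(1) CE(1) e bd cE lu by auto
  qed (use e lu in auto)
  moreover have "hankel_det (insert e E) \<in> polyS n"
    by (rule hankel_det_interval_polyS[of _ "Suc l" "u - 1"]) (use e ES cards cE bd in auto)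
  moreover have "subst v (hankel_det (insert e E)) \<noteq> 0"
    by (rule nz) (use e ES cards cE in auto)
  ultimately show "\<exists>g\<in>polyS n. subst v g \<noteq> 0 \<and> hankel_det C * g \<in> A"
    unfolding CE(1) by blast
qed

section \<open>The invariant of the descent and its step\<close>

locale hankel_classes =
  fixes n :: nat and f :: "'k::field mpoly"
  assumes n: "n \<ge> 2" and f: "f \<in> polyS n"
begin

text \<open>A row labelled c ends in x_(c+k): the row range 1..n - k - 1 means entries x_1, ...,
  x_(n-1), and 2..n - k means x_2, ..., x_n.\<close>

definition pair_state :: "nat \<Rightarrow> bool" where
  "pair_state k \<longleftrightarrow> (\<exists>A1\<in>classC n f. \<exists>A2\<in>classC n f.
     (\<forall>p\<in>A1. subst (sec n k False True) p = 0) \<and> contains_dets A1 (Suc k) 1 (n - k - 1) \<and>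
     (\<forall>p\<in>A2. subst (sec n k True False) p = 0) \<and> contains_dets A2 (Suc k) 2 (n - k))"

lemma sum_vanish:
  assumes "\<forall>p\<in>A1. subst v p = 0" "\<forall>p\<in>A2. subst v p = 0" "p \<in> sum_ideal A1 A2"
  shows "subst v p = 0"
  using assms by (auto simp: sum_ideal_def)

text \<open>The k-th secant variety lies in both joins, so the sum of the two ideals vanishes on it.
  The multipliers for the missing determinants are k-minors, which do not vanish there.\<close>

lemma full_ideal:
  assumes S: "pair_state k" and k: "2 * k + 2 \<le> n"
  obtains B where "B \<in> classC n f" "\<And>p. p \<in> B \<Longrightarrow> subst (sec n k False False) p = 0" "contains_dets B (Suc k) 1 (n - k)"
proof -
  let ?v = "sec n k False False :: nat \<Rightarrow> 'k mpoly"
  obtain A1 A2 where A: "A1 \<in> classC n f" "A2 \<in> classC n f" "\<forall>p\<in>A1. subst (sec n k False True) p = 0"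
    "\<forall>p\<in>A2. subst (sec n k True False) p = 0" "contains_dets A1 (Suc k) 1 (n - k - 1)" "contains_dets A2 (Suc k) 2 (n - k)"
    using S unfolding pair_state_def by blast
  note I = is_idealS_classC[OF f A(1)] is_idealS_classC[OF f A(2)]
  have "\<forall>p\<in>A1. subst ?v p = 0" "\<forall>p\<in>A2. subst ?v p = 0"
    using A(3,4) by (blast intro: sec_mono)+
  note van = sum_vanish[OF this]
  show ?thesis
  proof (rule extend_interval[OF f classC.plus[OF A(1,2)] van, of 1 "Suc k" "n - k"])
    show "contains_dets (sum_ideal A1 A2) (Suc k) 1 (n - k - 1)"
      by (rule contains_dets_mono[OF A(5) sum_ideal_left[OF I(2)]])
    show "contains_dets (sum_ideal A1 A2) (Suc k) (Suc 1) (n - k)"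
      using contains_dets_mono[OF A(6) sum_ideal_right[OF I(1)]] by (simp add: numeral_2_eq_2)
    show "subst ?v (hankel_det D) \<noteq> 0" if "D \<subseteq> {Suc 1..n - k - 1}" "Suc (card D) = Suc k" for D
      by (rule secant_hankel_det_nonzero[OF n _ that(1)]) (use that(2) k in simp_all)
  qed (use k that in auto)
qed

text \<open>Size drops by one by exchanging a row against the end rows 1 and L of the larger
  determinants. This reaches the row ranges 2..L - 1 and 3..L, which \<open>extend_interval\<close>
  merges into 2..L.\<close>

lemma middle_ideal:
  assumes S: "pair_state (Suc k)" and k: "2 * k + 4 \<le> n"
  obtains B where "B \<in> classC n f" "\<And>p. p \<in> B \<Longrightarrow> subst (sec n k True True) p = 0" "contains_dets B (Suc k) 2 (n - Suc k)"
proof -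
  let ?v = "sec n k True True :: nat \<Rightarrow> 'k mpoly"
  define L where "L = n - Suc k"
  have L: "L + k + 1 = n" "k + 3 \<le> L" using k by (auto simp: L_def)
  obtain A1 A2 where A: "A1 \<in> classC n f" "A2 \<in> classC n f" "\<forall>p\<in>A1. subst (sec n (Suc k) False True) p = 0"
    "\<forall>p\<in>A2. subst (sec n (Suc k) True False) p = 0" "contains_dets A1 (Suc (Suc k)) 1 (L - 1)" "contains_dets A2 (Suc (Suc k)) 2 L"
    using S unfolding pair_state_def L_def by auto
  let ?A = "sum_ideal A1 A2"
  note I = is_idealS_classC[OF f A(1)] is_idealS_classC[OF f A(2)]
  note IA = is_idealS_sum_ideal[OF I]
  have kn: "k < n" using k by simp
  have "\<forall>p\<in>A1. subst ?v p = 0" "\<forall>p\<in>A2. subst ?v p = 0"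
    using A(3,4) by (blast intro: sec_Suc_left[OF kn] sec_Suc_right[OF kn])+
  note van = sum_vanish[OF this]
  have cd1: "contains_dets ?A (Suc (Suc k)) 1 (L - 1)"
    by (rule contains_dets_mono[OF A(5) sum_ideal_left[OF I(2)]])
  have cd2: "contains_dets ?A (Suc (Suc k)) 2 L"
    by (rule contains_dets_mono[OF A(6) sum_ideal_right[OF I(1)]])
  \<comment> \<open>One multiplier serves \<open>C\<close> and its shift, since both unit rows may
    be used in the exchange.\<close>
  have key: "\<exists>g\<in>polyS n. subst ?v g \<noteq> 0 \<and> hankel_det C * g \<in> ?A \<and> hankel_det (Suc ` C) * g \<in> ?A"
    if C: "C \<subseteq> {2..L - 1}" "card C = Suc k" for C
  proof -
    have "finite C" using C(1) by (rule finite_subset) simp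
    obtain e where e: "e \<in> C" using C(2) by fastforce
    define E where "E = C - {e}"
    have E: "C = insert e E" "e \<notin> E" "finite E" "card E = k" using e C \<open>finite C\<close> by (auto simp: E_def)
    have mem: "2 \<le> x \<and> x \<le> L - 1" if "x \<in> C" for x using C(1) that by auto
    have notin: "1 \<notin> C" "L \<notin> C" using mem[of 1] mem[of L] L by auto
    have cards: "card (insert 1 C) = Suc (Suc k)" "card (insert L C) = Suc (Suc k)"
      using notin C(2) \<open>finite C\<close> by auto
    have pe: "hankel_det (insert 1 (insert e E)) \<in> ?A"
      unfolding E(1)[symmetric] by (rule contains_detsD[OF cd1 _ cards(1)]) (use mem L in force)
    have qe: "hankel_det (insert L (insert e E)) \<in> ?A"
      unfolding E(1)[symmetric] by (rule contains_detsD[OF cd2 _ cards(2)]) (use mem L in force)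
    \<comment> \<open>With rows 1 and L the diagonal begins with x_1 and ends with x_n, so this
      determinant is nonzero on the join with both coordinate points.\<close>
    let ?g = "hankel_det (insert 1 (insert L E)) :: 'k mpoly"
    have cg: "card (insert 1 (insert L E)) = Suc (Suc k)" using notin E L by auto
    have bd: "1 \<le> c \<and> c + card E + 1 \<le> n" if "c \<in> {1, L, e} \<union> E" for c
      using that mem[of c] E L by auto
    have ex: "?g * hankel_det (Suc ` insert e E) \<in> ?A" "?g * hankel_det (insert e E) \<in> ?A"
      using notin E(1,2) L bd by (intro hankel_det_exchange[OF IA E(3) _ _ E(2) _ _ _ _ pe qe]; auto)+
    have bd': "1 \<le> c \<and> c + card (insert 1 (insert L E)) \<le> Suc n" if "c \<in> insert 1 (insert L E)" for c
      using bd[of c] that unfolding cg E(4) by auto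
    have "subst ?v ?g \<noteq> 0"
    proof (rule sec_hankel_det_nonzero[OF n])
      show "Suc n - card (insert 1 (insert L E)) \<in> insert 1 (insert L E)" unfolding cg using L by auto
    qed (use kn cg bd' E in auto)
    moreover have "?g \<in> polyS n" using E(3) bd' by (intro hankel_det_polyS) auto
    ultimately show ?thesis using ex E(1) by (auto simp: mult.commute)
  qed
  obtain B1 where B1: "B1 \<in> classC n f" "?A \<subseteq> B1" "\<And>p. p \<in> B1 \<Longrightarrow> subst ?v p = 0" "contains_dets B1 (Suc k) 2 (L - 1)"
  proof (rule extend_dets[OF f classC.plus[OF A(1,2)] van, of 2 "L - 1" "Suc k"])
    show "\<exists>g\<in>polyS n. subst ?v g \<noteq> 0 \<and> hankel_det C * g \<in> ?A" if "C \<subseteq> {2..L - 1}" "card C = Suc k" for C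
      using key[OF that] by blast
  qed (use L that in auto)
  have shift: "\<exists>g\<in>polyS n. subst ?v g \<noteq> 0 \<and> hankel_det C * g \<in> B1"
    if C: "C \<subseteq> {Suc 2..L}" "card C = Suc k" for C
  proof -
    define C' where "C' = (\<lambda>x. x - 1) ` C"
    have C': "C = Suc ` C'" "C' \<subseteq> {2..L - 1}" using C(1) by (force simp: C'_def image_image)+
    have "card C' = Suc k" using C(2) unfolding C'(1) by (simp add: card_image)
    thus ?thesis using key[OF C'(2)] B1(2) C'(1) by blast
  qed
  obtain B2 where B2: "B2 \<in> classC n f" "B1 \<subseteq> B2" "\<And>p. p \<in> B2 \<Longrightarrow> subst ?v p = 0" "contains_dets B2 (Suc k) (Suc 2) L"
  proof (rule extend_dets[OF f B1(1,3), of "Suc 2" L "Suc k"])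
    show "\<exists>g\<in>polyS n. subst ?v g \<noteq> 0 \<and> hankel_det C * g \<in> B1" if "C \<subseteq> {Suc 2..L}" "card C = Suc k" for C
      by (rule shift[OF that])
  qed (use L that in auto)
  have low: "contains_dets B2 (Suc k) 2 (L - 1)" by (rule contains_dets_mono[OF B1(4) B2(2)])
  show ?thesis
  proof (rule extend_interval[OF f B2(1,3) _ _ _ low B2(4)])
    show "subst ?v (hankel_det D) \<noteq> 0" if D: "D \<subseteq> {Suc 2..L - 1}" "Suc (card D) = Suc k" for D
    proof
      \<comment> \<open>Vanishing on the join would force vanishing on the k-th secant variety
        inside it.\<close>
      assume "subst ?v (hankel_det D) = 0"
      hence "subst (sec n k False False) (hankel_det D) = (0 :: 'k mpoly)" by (rule sec_mono[rotated 2]) auto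
      moreover have "subst (sec n k False False) (hankel_det D) \<noteq> (0 :: 'k mpoly)"
        by (rule secant_hankel_det_nonzero[OF n _ D(1)]) (use D(2) L in simp_all)
      ultimately show False by simp
    qed
  qed (use that L in \<open>auto simp: L_def\<close>)
qed

text \<open>Modulo the full ideal, of size k + 2, the shift relation moves a factor from one product
  to another; the middle ideal, of size k + 1, puts one of these products into the sum. This adjoins
  determinants starting with row 1 to get \<open>A1\<close>, and those ending with row L + 1 to get
  \<open>A2\<close>.\<close>

lemma pair_state_step:
  assumes S: "pair_state (Suc k)" and k: "2 * k + 4 \<le> n"
  shows "pair_state k"
proof -
  define L where "L = n - Suc k"
  have L: "L + k + 1 = n" "k + 3 \<le> L" "n - k - 1 = L" "n - k = Suc L" using k by (auto simp: L_def)
  have kn: "k < n" using k by simp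
  obtain P where P: "P \<in> classC n f" "\<And>p. p \<in> P \<Longrightarrow> subst (sec n (Suc k) False False) p = 0" "contains_dets P (Suc (Suc k)) 1 L"
    using full_ideal[OF S] k by (auto simp: L_def)
  obtain B where B: "B \<in> classC n f" "\<And>p. p \<in> B \<Longrightarrow> subst (sec n k True True) p = 0" "contains_dets B (Suc k) 2 L"
    using middle_ideal[OF S k] by (auto simp: L_def)
  let ?M = "sum_ideal P B"
  note I = is_idealS_classC[OF f P(1)] is_idealS_classC[OF f B(1)]
  note IM = is_idealS_sum_ideal[OF I] and MC = classC.plus[OF P(1) B(1)]
  have cdP: "contains_dets ?M (Suc (Suc k)) 1 L" by (rule contains_dets_mono[OF P(3) sum_ideal_left[OF I(2)]])
  have cdB: "contains_dets ?M (Suc k) 2 L" by (rule contains_dets_mono[OF B(3) sum_ideal_right[OF I(1)]])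
  have van1: "subst (sec n k False True) p = 0" if "p \<in> ?M" for p
    using sum_vanish[OF _ _ that] P(2) B(2) by (metis sec_Suc_right[OF kn] sec_mono)
  have van2: "subst (sec n k True False) p = 0" if "p \<in> ?M" for p
    using sum_vanish[OF _ _ that] P(2) B(2) by (metis sec_Suc_left[OF kn] sec_mono)
  have shift: "hankel_det (Suc ` insert p E) * hankel_det (insert q E) \<in> ?M
      \<longleftrightarrow> hankel_det (Suc ` insert q E) * hankel_det (insert p E) \<in> ?M"
    if "finite E" "p \<notin> E" "q \<notin> E" "p \<noteq> q" "{p, q} \<union> E \<subseteq> {1..L}" "card E = k" for p q E
  proof (rule hankel_det_shift[OF IM that(1-4)])
    show "1 \<le> c \<and> c + card E + 1 \<le> n" if "c \<in> {p, q} \<union> E" for c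
      using \<open>{p, q} \<union> E \<subseteq> {1..L}\<close> that \<open>card E = k\<close> L by auto
    have "card (insert p (insert q E)) = Suc (Suc k)" using that by simp
    thus "hankel_det (insert p (insert q E)) \<in> ?M" using that(5) by (intro contains_detsD[OF cdP]) auto
  qed
  obtain A1 where A1: "A1 \<in> classC n f" "\<And>p. p \<in> A1 \<Longrightarrow> subst (sec n k False True) p = 0" "contains_dets A1 (Suc k) 1 L"
  proof (rule extend_dets[OF f MC van1, of 1 L "Suc k"])
    fix C assume C: "C \<subseteq> {1..L}" "card C = Suc k" "hankel_det C \<notin> ?M"
    have fin: "finite C" using C(1) by (rule finite_subset) simp
    have "1 \<in> C"
    proof (rule ccontr)
      assume "1 \<notin> C"
      hence "2 \<le> x \<and> x \<le> L" if "x \<in> C" for x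
        using subsetD[OF C(1) that] that by (cases "x = 1") auto
      hence "C \<subseteq> {2..L}" by auto
      thus False using contains_detsD[OF cdB _ C(2)] C(3) by blast
    qed
    define E where "E = C - {1}"
    have "2 \<le> x \<and> x \<le> L" if "x \<in> E" for x
      using subsetD[OF C(1), of x] that by (auto simp: E_def)
    hence "E \<subseteq> {2..L}" by auto
    moreover have "C = insert 1 E" "1 \<notin> E" "finite E" "card E = k"
      using \<open>1 \<in> C\<close> C(2) fin by (auto simp: E_def)
    ultimately have E: "C = insert 1 E" "1 \<notin> E" "finite E" "card E = k" "E \<subseteq> {2..L}"
      by blast+
    \<comment> \<open>Having L among these rows makes the shifted multiplier end with row L + 1, so
      its diagonal ends with x_n, as the join with the point of x_n requires.\<close>
    obtain q where q: "q \<in> {2..L}" "q \<notin> E" "L \<in> insert q E"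
    proof (cases "L \<in> E")
      case True
      obtain q where "q \<in> {2..L}" "q \<notin> E" using ex_fresh[of E "{2..L}"] E(3,4) L by fastforce
      thus ?thesis using True that by blast
    next
      case False
      thus ?thesis using L by (intro that[of L]) auto
    qed
    have cq: "card (insert q E) = Suc k" using q E by simp
    have "hankel_det (insert q E) \<in> ?M" using q E by (intro contains_detsD[OF cdB _ cq]) auto
    let ?g = "hankel_det (Suc ` insert q E) :: 'k mpoly"
    have cg: "card (Suc ` insert q E) = Suc k" by (simp only: card_image inj_Suc cq inj_on_subset[OF inj_Suc subset_UNIV])
    have bd: "1 \<le> c \<and> c + card (Suc ` insert q E) \<le> Suc n" if "c \<in> Suc ` insert q E" for c
      using that q E L unfolding cg by auto
    have fg: "finite (Suc ` insert q E)" using E by simp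
    have gS: "?g \<in> polyS n" by (rule hankel_det_polyS[OF fg bd])
    have c1: "card (Suc ` insert 1 E) = Suc k"
      using C(2) unfolding E(1) by (simp only: card_image inj_on_subset[OF inj_Suc subset_UNIV])
    have "Suc ` insert 1 E \<subseteq> {1..Suc L}" using C(1) unfolding E(1) by auto
    hence "hankel_det (Suc ` insert 1 E) \<in> polyS n"
      by (rule hankel_det_interval_polyS) (use c1 L in simp_all)
    hence "hankel_det (Suc ` insert 1 E) * hankel_det (insert q E) \<in> ?M"
      by (rule is_idealS_mult[OF IM \<open>hankel_det (insert q E) \<in> ?M\<close>])
    hence "?g * hankel_det (insert 1 E) \<in> ?M"
      by (subst (asm) shift) (use q E L in auto)
    moreover have "subst (sec n k False True) ?g \<noteq> 0"
    proof (rule sec_hankel_det_nonzero[OF n _ fg bd])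
      show "Suc n - card (Suc ` insert q E) \<in> Suc ` insert q E"
        unfolding cg using q(3) L by (auto simp: image_iff)
    qed (use kn in \<open>simp_all only: cg, simp_all\<close>)
    ultimately show "\<exists>g\<in>polyS n. subst (sec n k False True) g \<noteq> 0 \<and> hankel_det C * g \<in> ?M"
      using gS unfolding E(1) by (auto simp: mult.commute)
  qed (use L that in auto)
  obtain A2 where A2: "A2 \<in> classC n f" "\<And>p. p \<in> A2 \<Longrightarrow> subst (sec n k True False) p = 0" "contains_dets A2 (Suc k) 2 (Suc L)"
  proof (rule extend_dets[OF f MC van2, of 2 "Suc L" "Suc k"])
    fix C assume C: "C \<subseteq> {2..Suc L}" "card C = Suc k" "hankel_det C \<notin> ?M"
    have fin: "finite C" using C(1) by (rule finite_subset) simp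
    have "Suc L \<in> C"
    proof (rule ccontr)
      assume "Suc L \<notin> C"
      hence "2 \<le> x \<and> x \<le> L" if "x \<in> C" for x
        using subsetD[OF C(1) that] that by (cases "x = Suc L") auto
      hence "C \<subseteq> {2..L}" by auto
      thus False using contains_detsD[OF cdB _ C(2)] C(3) by blast
    qed
    \<comment> \<open>\<open>C\<close> is written as the shift of \<open>insert L E\<close>, so that
      the shift relation applies with the row L.\<close>
    define E where "E = (\<lambda>x. x - 1) ` C - {L}"
    have Suc_pred: "Suc (x - 1) = x" if "x \<in> C" for x
      using subsetD[OF C(1) that] by simp
    have "Suc ` (\<lambda>x. x - 1) ` C = C"
      unfolding image_image using Suc_pred by (simp only: image_cong[OF refl Suc_pred] image_ident)
    hence SE: "Suc ` E = C - {Suc L}"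
      unfolding E_def by (simp add: image_set_diff)
    have E: "C = Suc ` insert L E" "L \<notin> E" "finite E" using SE \<open>Suc L \<in> C\<close> fin by (auto simp: E_def)
    have cE: "card E = k" 
    proof -
      have "card (insert L E) = Suc k"
        using C(2) unfolding E(1) by (simp only: card_image inj_on_subset[OF inj_Suc subset_UNIV])
      thus ?thesis using E(2,3) by simp
    qed
    have ES: "E \<subseteq> {1..L}"
    proof
      fix x assume "x \<in> E"
      hence "Suc x \<in> C" using SE by blast
      thus "x \<in> {1..L}" using subsetD[OF C(1), of "Suc x"] by simp
    qed
    \<comment> \<open>Row 1 puts x_1 on the diagonal of the multiplier, as the join with the point
      of x_1 requires; p \<noteq> L keeps the shifted rows within 2..L.\<close>
    obtain p where p: "p \<in> {1..L - 1}" "p \<notin> E" "1 \<in> insert p E"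
    proof (cases "1 \<in> E")
      case True
      obtain p where "p \<in> {1..L - 1}" "p \<notin> E" using ex_fresh[of E "{1..L - 1}"] E(3) cE L by fastforce
      thus ?thesis using True that by blast
    next
      case False
      thus ?thesis using L by (intro that[of 1]) auto
    qed
    have cp: "card (insert p E) = Suc k" using p E cE by simp
    have cSp: "card (Suc ` insert p E) = Suc k" by (simp only: card_image inj_Suc cp inj_on_subset[OF inj_Suc subset_UNIV])
    have "x < L" if "x \<in> E" for x using ES E(2) that by (cases "x = L") force+
    hence "2 \<le> Suc x \<and> Suc x \<le> L" if "x \<in> insert p E" for x
      using that p(1) L(2) subsetD[OF ES, of x] by (cases "x = p") fastforce+
    hence "Suc ` insert p E \<subseteq> {2..L}" by auto
    hence "hankel_det (Suc ` insert p E) \<in> ?M" by (rule contains_detsD[OF cdB _ cSp])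
    moreover have "hankel_det (insert L E) \<in> polyS n"
      by (rule hankel_det_interval_polyS[of _ 1 L]) (use ES E cE L in auto)
    ultimately have "hankel_det (Suc ` insert p E) * hankel_det (insert L E) \<in> ?M"
      using is_idealS_mult[OF IM] by (metis mult.commute)
    hence "hankel_det (Suc ` insert L E) * hankel_det (insert p E) \<in> ?M"
      by (subst (asm) shift) (use p E ES cE L in auto)
    moreover have bd: "1 \<le> c \<and> c + card (insert p E) \<le> Suc n" if "c \<in> insert p E" for c
      using that ES p(1) L unfolding cp by auto
    moreover have "hankel_det (insert p E) \<in> polyS n" using E(3) bd by (intro hankel_det_polyS) auto
    moreover have "subst (sec n k True False) (hankel_det (insert p E)) \<noteq> (0 :: 'k mpoly)"
      by (rule sec_hankel_det_nonzero[OF n _ _ bd]) (use kn E(3) cp p(3) in auto)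
    ultimately show "\<exists>g\<in>polyS n. subst (sec n k True False) g \<noteq> 0 \<and> hankel_det C * g \<in> ?M"
      unfolding E(1) by blast
  qed (use L that in auto)
  have "contains_dets A1 (Suc k) 1 (n - k - 1)" "contains_dets A2 (Suc k) 2 (n - k)"
    using A1(3) A2(3) by (simp_all only: L(4) diff_Suc_1)
  thus ?thesis
    unfolding pair_state_def
    by (intro bexI[OF _ A1(1)] bexI[OF _ A2(1)] conjI ballI A1(2) A2(2))
qed

end

section \<open>The start of the descent and the theorem\<close>

lemma det_hankel_square:
  assumes "u + 2 - m - l = m"
  shows "det (hankel m l u) = (hankel_det {l..<l + m} :: 'k::field mpoly)"
  unfolding hankel_det_def bracket_def hankel_def assms
  by (intro arg_cong[where f = det] eq_matI) (auto simp: hankel_row_def)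

lemma sec_square_zero:
  assumes "n \<ge> 2" "k \<le> n" "1 + of_bool \<alpha> \<le> l" "l + 2 * k + of_bool \<beta> \<le> n"
  shows "subst (sec n k \<alpha> \<beta>) (hankel_det {l..<l + Suc k}) = (0 :: 'k::field mpoly)"
proof -
  have "(hankel_det {l..<l + Suc k} :: 'k mpoly) = det (mat (Suc k) (Suc k) (\<lambda>(i, j). var ((l + i) + j)))"
    unfolding hankel_det_def bracket_def
    by (intro arg_cong[where f = det] eq_matI) (auto simp: hankel_row_def simp del: upt_Suc)
  also have "subst (sec n k \<alpha> \<beta>) \<dots> = 0"
    by (rule sec_det_zero[OF assms(1,2), where D = k]) (use assms(3,4) in auto)
  finally show ?thesis .
qed

lemma vanish_ideal_genS:
  assumes f: "f \<in> polyS n" "subst v f = (0 :: 'k::field mpoly)" and p: "p \<in> ideal_genS n {f}"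
  shows "subst v p = 0"
proof -
  have "is_idealS n {p \<in> polyS n. subst v p = 0}"
    unfolding is_idealS_def by (auto intro: add_polyS mult_polyS)
  hence "ideal_genS n {f} \<subseteq> {p \<in> polyS n. subst v p = 0}"
    by (rule ideal_genS_least) (use f in auto)
  thus ?thesis using p by blast
qed

text \<open>For n = 2(k + 1) each of the two row ranges admits a single determinant, and
  \<open>f\<close> is the product of both. The colon of \<open>(f)\<close> by either factor adjoins
  the other.\<close>

lemma pair_state_start:
  fixes f :: "'k::field mpoly"
  assumes f_def: "f = hankel_det {1..<1 + Suc k} * hankel_det {2..<2 + Suc k}"
  shows "f \<in> polyS (2 * Suc k)" and "hankel_classes.pair_state (2 * Suc k) f k"
proof -
  let ?n = "2 * Suc k" and ?a = "hankel_det {1..<1 + Suc k} :: 'k mpoly" and ?b = "hankel_det {2..<2 + Suc k} :: 'k mpoly"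
  have a: "?a \<in> polyS ?n" by (rule hankel_det_interval_polyS[of _ 1 "Suc k"]) auto
  have b: "?b \<in> polyS ?n" by (rule hankel_det_interval_polyS[of _ 2 "Suc (Suc k)"]) auto
  show f: "f \<in> polyS ?n" unfolding f_def by (rule mult_polyS[OF a b])
  interpret hankel_classes ?n f by unfold_locales (simp, rule f)
  have fA: "f \<in> ideal_genS ?n {f}" using ideal_genS_superset by blast
  have za: "subst (sec ?n k False True) ?a = 0" and zb: "subst (sec ?n k True False) ?b = 0"
    by (rule sec_square_zero; simp)+
  have zf: "subst (sec ?n k False True) f = 0" "subst (sec ?n k True False) f = 0"
    unfolding f_def subst_mult za zb by simp_all
  \<comment> \<open>The diagonal of the second factor ends with x_n and that of the first begins
    with x_1; each factor is therefore nonzero on the join where the other one vanishes.\<close>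
  have nb: "subst (sec ?n k False True) ?b \<noteq> 0"
    by (rule sec_hankel_det_nonzero) auto
  have na: "subst (sec ?n k True False) ?a \<noteq> 0"
    by (rule sec_hankel_det_nonzero) auto
  obtain A1 where A1: "A1 \<in> classC ?n f" "\<And>p. p \<in> A1 \<Longrightarrow> subst (sec ?n k False True) p = 0" "contains_dets A1 (Suc k) 1 (Suc k)"
  proof (rule extend_dets[OF f classC.base vanish_ideal_genS[OF f zf(1)], of 1 "Suc k" "Suc k"])
    fix C assume "C \<subseteq> {1..Suc k}" "card C = Suc k"
    hence "C = {1..Suc k}" by (intro card_subset_eq) auto
    hence "hankel_det C * ?b = f" by (simp only: f_def atLeastLessThanSuc_atLeastAtMost add_Suc_right plus_1_eq_Suc)
    thus "\<exists>g\<in>polyS ?n. subst (sec ?n k False True) g \<noteq> 0 \<and> hankel_det C * g \<in> ideal_genS ?n {f}"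
      using b nb fA by (intro bexI[of _ ?b]) simp_all
  qed (use that in auto)
  obtain A2 where A2: "A2 \<in> classC ?n f" "\<And>p. p \<in> A2 \<Longrightarrow> subst (sec ?n k True False) p = 0" "contains_dets A2 (Suc k) 2 (Suc (Suc k))"
  proof (rule extend_dets[OF f classC.base vanish_ideal_genS[OF f zf(2)], of 2 "Suc (Suc k)" "Suc k"])
    fix C assume "C \<subseteq> {2..Suc (Suc k)}" "card C = Suc k"
    hence "C = {2..Suc (Suc k)}" by (intro card_subset_eq) auto
    hence "hankel_det C * ?a = f"
      by (simp only: f_def mult.commute atLeastLessThanSuc_atLeastAtMost add_Suc_right add_2_eq_Suc)
    thus "\<exists>g\<in>polyS ?n. subst (sec ?n k True False) g \<noteq> 0 \<and> hankel_det C * g \<in> ideal_genS ?n {f}"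
      using a na fA by (intro bexI[of _ ?a]) simp_all
  qed (use that in auto)
  have eq: "?n - k = Suc (Suc k)" by simp
  have "contains_dets A1 (Suc k) 1 (?n - k - 1)" "contains_dets A2 (Suc k) 2 (?n - k)"
    using A1(3) A2(3) by (simp_all only: eq diff_Suc_1)
  thus "pair_state k"
    unfolding pair_state_def
    by (intro bexI[OF _ A1(1)] bexI[OF _ A2(1)] conjI ballI A1(2) A2(2))
qed

theorem theorem3p3:
  fixes m t :: nat
  assumes "m \<ge> 1" and "1 \<le> t" and "t \<le> m"
  shows "minor_idealS (2*m) t (hankel m 1 (2*m) :: 'k::field mpoly mat)
           \<in> classC (2*m) (det (hankel m 1 (2*m - 1)) * det (hankel m 2 (2*m)) :: 'k mpoly)"
proof -
  define f where "f = (det (hankel m 1 (2*m - 1)) * det (hankel m 2 (2*m)) :: 'k mpoly)"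
  obtain K where K: "m = Suc K" using assms(1) by (cases m) auto
  obtain k where k: "t = Suc k" using assms(2) by (cases t) auto
  have f_eq: "f = hankel_det {1..<1 + Suc K} * hankel_det {2..<2 + Suc K}"
    unfolding f_def K by (intro arg_cong2[where f = "(*)"] det_hankel_square) simp_all
  interpret hankel_classes "2 * m" f
    by unfold_locales (use pair_state_start(1)[OF f_eq] K in simp_all)
  have "k \<le> K" using assms(3) k K by simp
  \<comment> \<open>Descending induction from K = m - 1 to k = t - 1.\<close>
  hence "pair_state k"
  proof (induction rule: inc_induct)
    case base
    show ?case using pair_state_start(2)[OF f_eq] K by simp
  next
    case (step j)
    show ?case by (rule pair_state_step[OF step.IH]) (use step.hyps K in simp)
  qed
  then obtain B where B: "B \<in> classC (2 * m) f" "\<And>p. p \<in> B \<Longrightarrow> subst (sec (2 * m) k False False) p = 0"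
    "contains_dets B (Suc k) 1 (2 * m - k)"
    using \<open>k \<le> K\<close> K by (elim full_ideal) auto
  have "minor_idealS (2 * m) (Suc k) (hankel m 1 (2 * m)) = B"
    by (rule minor_ideal_unique[OF assms(1) _ is_idealS_classC[OF pair_state_start(1)[OF f_eq, folded K] B(1)] B(2) contains_detsD[OF B(3)]])
       (use \<open>k \<le> K\<close> K in auto)
  thus ?thesis using B(1) unfolding f_def k by simp
qed

end
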